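(* Let $\mathcal{R}$ be a commutative ring containing $\mathbb{Q}$ and let $\phi(x)=\sum_{k\ge0}\phi[k]\frac{x^k}{k!}\in\mathcal{R}[[x]]$. The generating series $B_{n,k}^\phi(\mathbf{x},\mathbf{q})$ of forests of exactly $k$ $\phi$-enriched increasing trees with $n$ internal vertices in total satisfies $B_{1,1}^{\phi}(x_1;q_0)=\phi(x_1)q_0$ and, for $n\ge2$ and $1\le k\le n$, $$B_{n,k}^\phi(\mathbf{x},\mathbf{q})=\phi(x_1)q_0\,B_{n-1,k-1}^\phi(\mathbf{x},\mathbf{q})+\sum_{i=1}^{n-1}\phi(x_{i+1})\,q_i\,\partial_{x_i}B_{n-1,k}^\phi(\mathbf{x},\mathbf{q}),$$ where $B^\phi_{m,0}=0$ for $m\ge1$ and $B^\phi_{m,k}=0$ for $k>m$.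
   Context: Consider forests (unordered sets) of exactly $k$ (non-plane) rooted trees on a vertex set $[n]\uplus V$, where $[n]=\{1,\dots,n\}$ is the set of internal vertices and $V$ the set of leaves, such that all roots are internal vertices, the elements of $V$ have no children, and internal labels increase along each path starting at a root (internal vertices may have no children). The height $\mathrm{ht}(v)$ of a vertex is its distance to the root of its tree, and $T^{-1}(v)$ is the set of all children of $v$. For $\mathbf{k}=(k_1,\dots,k_n)$ and any finite set $V$ with a map $\kappa:V\to\{1,\dots,n\}$ satisfying $|\kappa^{-1}(i)|=k_i$, the coefficient of $\frac{x_1^{k_1}\cdots x_n^{k_n}}{k_1!\cdots k_n!}$ in $B^\phi_{n,k}(\mathbf{x},\mathbf{q})$ is $\sum\prod_{v\in[n]}\phi[|T^{-1}(v)|]\,q_{\mathrm{ht}(v)}$, the sum being over all such forests with exactly $k$ trees in which every leaf $v\in V$ has height $\kappa(v)$. *)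

theory Defs
  imports "HOL-Library.Poly_Mapping" "HOL-Computational_Algebra.Formal_Power_Series"
begin

section \<open>Multivariate formal power series\<close>

text \<open>
  Formal power series in the variables \<open>x\<^sub>0, x\<^sub>1, x\<^sub>2, \<dots>\<close>: arbitrary coefficient functions on the
  finitely supported exponents. A series in \<open>x\<^sub>1, \<dots>, x\<^sub>n\<close> is one whose coefficients vanish at all
  exponents not supported in \<open>{1..n}\<close>.
\<close>

typedef 'a mps = "UNIV :: ((nat \<Rightarrow>\<^sub>0 nat) \<Rightarrow> 'a) set"
  morphisms mps_coeff Abs_mps by simp

setup_lifting type_definition_mps

lemma mps_coeff_Abs [simp]: "mps_coeff (Abs_mps f) = f"
  by (simp add: Abs_mps_inverse)

lemma mps_eqI: "(\<And>e. mps_coeff f e = mps_coeff g e) \<Longrightarrow> f = g"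
  by (metis ext mps_coeff_inject)

definition splits :: "(nat \<Rightarrow>\<^sub>0 nat) \<Rightarrow> ((nat \<Rightarrow>\<^sub>0 nat) \<times> (nat \<Rightarrow>\<^sub>0 nat)) set" where
  "splits e = {(a, b). a + b = e}"

lemma finite_splits [simp]: "finite (splits e)"
proof -
  let ?S = "{f. \<forall>i. (i \<in> Poly_Mapping.keys e \<longrightarrow> f i \<in> {..Max (range (Poly_Mapping.lookup e))}) \<and>
                    (i \<notin> Poly_Mapping.keys e \<longrightarrow> f i = 0)}"
  have fr: "finite (range (Poly_Mapping.lookup e))"
  proof (rule finite_subset)
    show "range (Poly_Mapping.lookup e) \<subseteq> insert 0 (Poly_Mapping.lookup e ` Poly_Mapping.keys e)"
      by (auto simp: in_keys_iff)
  qed simp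
  have "finite ?S"
    by (rule finite_set_of_finite_funs) auto
  moreover have "(Poly_Mapping.lookup \<circ> fst) ` splits e \<subseteq> ?S"
  proof (rule image_subsetI)
    fix p assume "p \<in> splits e"
    then obtain a b where p: "p = (a, b)" and e: "e = a + b" by (auto simp: splits_def)
    have le: "Poly_Mapping.lookup a i \<le> Poly_Mapping.lookup e i" for i
      by (simp add: e lookup_add)
    show "(Poly_Mapping.lookup \<circ> fst) p \<in> ?S"
    proof (rule CollectI, intro allI conjI impI)
      fix i
      show "(Poly_Mapping.lookup \<circ> fst) p i \<in> {..Max (range (Poly_Mapping.lookup e))}"
        using le[of i] Max_ge[OF fr, of "Poly_Mapping.lookup e i"] by (auto simp: p)
      show "(Poly_Mapping.lookup \<circ> fst) p i = 0" if "i \<notin> Poly_Mapping.keys e"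
        using le[of i] that by (simp add: p in_keys_iff)
    qed
  qed
  ultimately have fin: "finite ((Poly_Mapping.lookup \<circ> fst) ` splits e)"
    by (rule rev_finite_subset)
  have "inj_on (Poly_Mapping.lookup \<circ> fst) (splits e)"
  proof (rule inj_onI, clarify)
    fix a b c d assume "(a, b) \<in> splits e" "(c, d) \<in> splits e"
      "(Poly_Mapping.lookup \<circ> fst) (a, b) = (Poly_Mapping.lookup \<circ> fst) (c, d)"
    then show "a = c \<and> b = d" by (auto simp: splits_def lookup_inject)
  qed
  with fin show ?thesis by (rule finite_imageD)
qed

instantiation mps :: (comm_ring_1) comm_ring_1
begin

lift_definition zero_mps :: "'a mps" is "\<lambda>_. 0" .
lift_definition one_mps :: "'a mps" is "\<lambda>e. if e = 0 then 1 else 0" .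
lift_definition plus_mps :: "'a mps \<Rightarrow> 'a mps \<Rightarrow> 'a mps" is "\<lambda>f g e. f e + g e" .
lift_definition minus_mps :: "'a mps \<Rightarrow> 'a mps \<Rightarrow> 'a mps" is "\<lambda>f g e. f e - g e" .
lift_definition uminus_mps :: "'a mps \<Rightarrow> 'a mps" is "\<lambda>f e. - f e" .
lift_definition times_mps :: "'a mps \<Rightarrow> 'a mps \<Rightarrow> 'a mps"
  is "\<lambda>f g e. \<Sum>(a, b)\<in>splits e. f a * g b" .

instance
proof
  fix f g h :: "'a mps"
  show "f + g + h = f + (g + h)" "f + g = g + f" "0 + f = f" "- f + f = 0" "f - g = f + - g"
    by (transfer; simp add: algebra_simps)+
  show "(0::'a mps) \<noteq> 1"
    by transfer (metis zero_neq_one)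
  show "(f + g) * h = f * h + g * h"
    by transfer (simp add: distrib_right sum.distrib case_prod_unfold)
  show "f * g = g * f"
  proof (transfer, rule ext)
    fix f g :: "(nat \<Rightarrow>\<^sub>0 nat) \<Rightarrow> 'a" and e
    show "(\<Sum>(a, b)\<in>splits e. f a * g b) = (\<Sum>(a, b)\<in>splits e. g a * f b)"
      by (rule sum.reindex_bij_witness[of _ prod.swap prod.swap])
         (auto simp: splits_def add.commute mult.commute)
  qed
  show "1 * f = f"
  proof (transfer, rule ext)
    fix f :: "(nat \<Rightarrow>\<^sub>0 nat) \<Rightarrow> 'a" and e
    have "(\<Sum>(a, b)\<in>splits e. (if a = 0 then 1 else 0) * f b)
        = (\<Sum>(a, b)\<in>{(0 :: nat \<Rightarrow>\<^sub>0 nat, e)}. (if a = 0 then 1 else 0) * f b)"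
    proof (rule sum.mono_neutral_right)
      show "\<forall>p\<in>splits e - {(0, e)}. (case p of (a, b) \<Rightarrow> (if a = 0 then 1 else 0) * f b) = 0"
        by (auto simp: splits_def split: if_split_asm)
      show "{(0, e)} \<subseteq> splits e" by (simp add: splits_def)
    qed simp
    then show "(\<Sum>(a, b)\<in>splits e. (if a = 0 then 1 else 0) * f b) = f e" by simp
  qed
  show "f * g * h = f * (g * h)"
  proof (transfer, rule ext)
    fix f g h :: "(nat \<Rightarrow>\<^sub>0 nat) \<Rightarrow> 'a" and e
    have "(\<Sum>(a, b)\<in>splits e. (\<Sum>(c, d)\<in>splits a. f c * g d) * h b)
        = (\<Sum>(p, q)\<in>(SIGMA p:splits e. splits (fst p)). f (fst q) * g (snd q) * h (snd p))"
      by (subst sum.Sigma[symmetric]) (simp_all add: case_prod_unfold sum_distrib_right)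
    also have "\<dots> = (\<Sum>(p, q)\<in>(SIGMA p:splits e. splits (snd p)). f (fst p) * g (fst q) * h (snd q))"
      by (rule sum.reindex_bij_witness
            [of _ "\<lambda>((a, b), (c, d)). ((a + c, d), (a, c))" "\<lambda>((a, b), (c, d)). ((c, d + b), (d, b))"])
         (auto simp: splits_def add.assoc)
    also have "\<dots> = (\<Sum>(a, b)\<in>splits e. f a * (\<Sum>(c, d)\<in>splits b. g c * h d))"
      by (subst sum.Sigma[symmetric]) (simp_all add: case_prod_unfold sum_distrib_left mult.assoc)
    finally show "(\<Sum>(a, b)\<in>splits e. (\<Sum>(c, d)\<in>splits a. f c * g d) * h b)
        = (\<Sum>(a, b)\<in>splits e. f a * (\<Sum>(c, d)\<in>splits b. g c * h d))" .
  qed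
qed

end

definition mps_const :: "'a::comm_ring_1 \<Rightarrow> 'a mps" where
  "mps_const c = Abs_mps (\<lambda>e. if e = 0 then c else 0)"

text \<open>\<open>mps_of_fps i f\<close> is the univariate series \<open>f\<close> evaluated at the variable \<open>x\<^sub>i\<close>.\<close>

definition mps_of_fps :: "nat \<Rightarrow> 'a::comm_ring_1 fps \<Rightarrow> 'a mps" where
  "mps_of_fps i f =
     Abs_mps (\<lambda>e. if Poly_Mapping.keys e \<subseteq> {i} then fps_nth f (Poly_Mapping.lookup e i) else 0)"

definition mps_deriv :: "nat \<Rightarrow> 'a::comm_ring_1 mps \<Rightarrow> 'a mps" where
  "mps_deriv i f = Abs_mps (\<lambda>e.
     of_nat (Poly_Mapping.lookup e i + 1) * mps_coeff f (e + Poly_Mapping.single i 1))"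


section \<open>The coefficient ring\<close>

text \<open>A ring containing the rationals comes with an injective unital ring homomorphism from \<open>rat\<close>.\<close>

definition rat_embedding :: "(rat \<Rightarrow> 'a::comm_ring_1) \<Rightarrow> bool" where
  "rat_embedding \<iota> \<longleftrightarrow> inj \<iota> \<and> \<iota> 1 = 1 \<and>
     (\<forall>a b. \<iota> (a + b) = \<iota> a + \<iota> b) \<and> (\<forall>a b. \<iota> (a * b) = \<iota> a * \<iota> b)"

text \<open>The polynomial ring over \<open>'a\<close> in the variables \<open>q\<^sub>0, q\<^sub>1, q\<^sub>2, \<dots>\<close>.\<close>

type_synonym 'a qpoly = "(nat \<Rightarrow>\<^sub>0 nat) \<Rightarrow>\<^sub>0 'a"

definition qconst :: "'a::comm_ring_1 \<Rightarrow> 'a qpoly" where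
  "qconst c = Poly_Mapping.single 0 c"

definition qvar :: "nat \<Rightarrow> 'a::comm_ring_1 qpoly" where
  "qvar i = Poly_Mapping.single (Poly_Mapping.single i 1) 1"


section \<open>Increasing forests\<close>

text \<open>
  Internal vertices are \<open>Inl i\<close> with \<open>1 \<le> i \<le> n\<close>, leaves are \<open>Inr v\<close> with \<open>v \<in> V\<close>.
  A rooted forest is given by its set of edges, directed from parent to child.
\<close>

definition vertices :: "nat \<Rightarrow> 'v set \<Rightarrow> (nat + 'v) set" where
  "vertices n V = Inl ` {1..n} \<union> Inr ` V"

definition rooted_forest :: "'b set \<Rightarrow> ('b \<times> 'b) set \<Rightarrow> bool" where
  "rooted_forest W E \<longleftrightarrow> E \<subseteq> W \<times> W \<and> acyclic E \<and>
     (\<forall>u u' v. (u, v) \<in> E \<longrightarrow> (u', v) \<in> E \<longrightarrow> u = u')"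

definition roots :: "'b set \<Rightarrow> ('b \<times> 'b) set \<Rightarrow> 'b set" where
  "roots W E = {v \<in> W. \<forall>u. (u, v) \<notin> E}"

definition children :: "('b \<times> 'b) set \<Rightarrow> 'b \<Rightarrow> 'b set" where
  "children E v = {w. (v, w) \<in> E}"

definition ht :: "'b set \<Rightarrow> ('b \<times> 'b) set \<Rightarrow> 'b \<Rightarrow> nat" where
  "ht W E v = (LEAST m. \<exists>r\<in>roots W E. (r, v) \<in> E ^^ m)"

text \<open>
  The forests of exactly \<open>k\<close> trees (i.e. with exactly \<open>k\<close> roots) in which each leaf \<open>v\<close> has
  height \<open>\<kappa> v\<close>.
\<close>

definition forests :: "nat \<Rightarrow> nat \<Rightarrow> 'v set \<Rightarrow> ('v \<Rightarrow> nat) \<Rightarrow> ((nat + 'v) \<times> (nat + 'v)) set set" where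
  "forests n k V \<kappa> = {E. rooted_forest (vertices n V) E \<and>
     card (roots (vertices n V) E) = k \<and>
     roots (vertices n V) E \<subseteq> Inl ` {1..n} \<and>
     (\<forall>v\<in>V. children E (Inr v) = {}) \<and>
     (\<forall>i j. (Inl i, Inl j) \<in> E \<longrightarrow> i < j) \<and>
     (\<forall>v\<in>V. ht (vertices n V) E (Inr v) = \<kappa> v)}"

definition forest_weight ::
    "(nat \<Rightarrow> 'a::comm_ring_1) \<Rightarrow> nat \<Rightarrow> 'v set \<Rightarrow> ((nat + 'v) \<times> (nat + 'v)) set \<Rightarrow> 'a qpoly" where
  "forest_weight \<phi> n V E =
     (\<Prod>v\<in>{1..n}. qconst (\<phi> (card (children E (Inl v)))) * qvar (ht (vertices n V) E (Inl v)))"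

definition forest_sum ::
    "(nat \<Rightarrow> 'a::comm_ring_1) \<Rightarrow> nat \<Rightarrow> nat \<Rightarrow> 'v set \<Rightarrow> ('v \<Rightarrow> nat) \<Rightarrow> 'a qpoly" where
  "forest_sum \<phi> n k V \<kappa> = (\<Sum>E\<in>forests n k V \<kappa>. forest_weight \<phi> n V E)"

lemma finite_forests:
  assumes "finite V"
  shows "finite (forests n k V \<kappa>)"
proof (rule finite_subset)
  show "forests n k V \<kappa> \<subseteq> Pow (vertices n V \<times> vertices n V)"
    by (auto simp: forests_def rooted_forest_def)
  show "finite (Pow (vertices n V \<times> vertices n V))"
    using assms by (simp add: vertices_def)
qed


section \<open>The generating series\<close>

text \<open>
  The standard leaf set with exponent \<open>e\<close>, whose leaf map is \<open>fst\<close>. Lemma \<open>Bser_coeff\<close> below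
  shows that any other finite leaf set with the same fibre sizes gives the same coefficient.
\<close>

definition leaf_set :: "nat \<Rightarrow> (nat \<Rightarrow>\<^sub>0 nat) \<Rightarrow> (nat \<times> nat) set" where
  "leaf_set n e = {(i, j). i \<in> {1..n} \<and> j < Poly_Mapping.lookup e i}"

definition exp_fact :: "(nat \<Rightarrow>\<^sub>0 nat) \<Rightarrow> rat" where
  "exp_fact e = (\<Prod>i\<in>Poly_Mapping.keys e. fact (Poly_Mapping.lookup e i))"

definition Bser :: "(rat \<Rightarrow> 'a::comm_ring_1) \<Rightarrow> (nat \<Rightarrow> 'a) \<Rightarrow> nat \<Rightarrow> nat \<Rightarrow> 'a qpoly mps" where
  "Bser \<iota> \<phi> n k = Abs_mps (\<lambda>e.
     if Poly_Mapping.keys e \<subseteq> {1..n}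
     then qconst (\<iota> (1 / exp_fact e)) * forest_sum \<phi> n k (leaf_set n e) fst
     else 0)"

definition phi_series :: "(rat \<Rightarrow> 'a::comm_ring_1) \<Rightarrow> (nat \<Rightarrow> 'a) \<Rightarrow> 'a fps" where
  "phi_series \<iota> \<phi> = Abs_fps (\<lambda>k. \<iota> (1 / fact k) * \<phi> k)"

text \<open>\<open>\<phi>(x\<^sub>i)\<close>, with coefficients regarded as constant polynomials in the \<open>q\<^sub>j\<close>.\<close>

definition phi_at :: "(rat \<Rightarrow> 'a::comm_ring_1) \<Rightarrow> (nat \<Rightarrow> 'a) \<Rightarrow> nat \<Rightarrow> 'a qpoly mps" where
  "phi_at \<iota> \<phi> i = mps_of_fps i (Abs_fps (\<lambda>k. qconst (fps_nth (phi_series \<iota> \<phi>) k)))"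


section \<open>Independence of the choice of the leaf set\<close>

lemma relpow_map_prod:
  assumes inj: "inj_on h W" and E: "E \<subseteq> W \<times> W" and u: "u \<in> W" and v: "v \<in> W"
  shows "(h u, h v) \<in> (map_prod h h ` E) ^^ m \<longleftrightarrow> (u, v) \<in> E ^^ m"
  using v
proof (induction m arbitrary: v)
  case 0
  then show ?case using inj u by (auto dest: inj_onD)
next
  case (Suc m)
  show ?case
  proof
    assume "(h u, h v) \<in> (map_prod h h ` E) ^^ Suc m"
    then obtain y where y: "(h u, y) \<in> (map_prod h h ` E) ^^ m" "(y, h v) \<in> map_prod h h ` E"
      by (elim relpow_Suc_E)
    from y(2) obtain a b where ab: "(a, b) \<in> E" "y = h a" "h v = h b"
      by (elim imageE) auto
    with E have "a \<in> W" "b \<in> W" by auto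
    then have "b = v" using inj_onD[OF inj ab(3)] Suc.prems by simp
    with Suc.IH[OF \<open>a \<in> W\<close>] y(1) ab(1,2) show "(u, v) \<in> E ^^ Suc m" by auto
  next
    assume "(u, v) \<in> E ^^ Suc m"
    then obtain a where a: "(u, a) \<in> E ^^ m" "(a, v) \<in> E" by auto
    with E Suc.IH[of a] have "(h u, h a) \<in> (map_prod h h ` E) ^^ m" by auto
    moreover have "(h a, h v) \<in> map_prod h h ` E" using a by force
    ultimately show "(h u, h v) \<in> (map_prod h h ` E) ^^ Suc m" by (rule relpow_Suc_I)
  qed
qed

lemma map_prod_mem_iff:
  assumes "inj_on h W" "E \<subseteq> W \<times> W" "v \<in> W"
  shows "(x, h v) \<in> map_prod h h ` E \<longleftrightarrow> (\<exists>u. x = h u \<and> (u, v) \<in> E)"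
    and "(h v, x) \<in> map_prod h h ` E \<longleftrightarrow> (\<exists>u. x = h u \<and> (v, u) \<in> E)"
proof -
  have *: "a = v" if "a \<in> W" "h a = h v" for a
    using inj_onD[OF assms(1) that(2,1) assms(3)] .
  show "(x, h v) \<in> map_prod h h ` E \<longleftrightarrow> (\<exists>u. x = h u \<and> (u, v) \<in> E)"
  proof
    assume "(x, h v) \<in> map_prod h h ` E"
    then obtain a b where "(a, b) \<in> E" "x = h a" "h b = h v" by auto
    with *[of b] assms(2) show "\<exists>u. x = h u \<and> (u, v) \<in> E" by auto
  qed force
  show "(h v, x) \<in> map_prod h h ` E \<longleftrightarrow> (\<exists>u. x = h u \<and> (v, u) \<in> E)"
  proof
    assume "(h v, x) \<in> map_prod h h ` E"
    then obtain a b where "(a, b) \<in> E" "x = h b" "h a = h v" by auto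
    with *[of a] assms(2) show "\<exists>u. x = h u \<and> (v, u) \<in> E" by auto
  qed force
qed

lemma roots_map_prod:
  assumes "inj_on h W" "E \<subseteq> W \<times> W"
  shows "roots (h ` W) (map_prod h h ` E) = h ` roots W E"
proof -
  have "(\<forall>u. (u, h v) \<notin> map_prod h h ` E) \<longleftrightarrow> (\<forall>u. (u, v) \<notin> E)" if "v \<in> W" for v
    using map_prod_mem_iff(1)[OF assms that] by simp
  then have "h v \<in> roots (h ` W) (map_prod h h ` E) \<longleftrightarrow> v \<in> roots W E" if "v \<in> W" for v
    using that by (simp add: roots_def)
  moreover have "roots (h ` W) (map_prod h h ` E) \<subseteq> h ` W" "roots W E \<subseteq> W"
    by (auto simp: roots_def)
  ultimately show ?thesis by blast
qed

lemma children_map_prod: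
  assumes "inj_on h W" "E \<subseteq> W \<times> W" "v \<in> W"
  shows "children (map_prod h h ` E) (h v) = h ` children E v"
  unfolding children_def map_prod_mem_iff(2)[OF assms] by auto

lemma ht_map_prod:
  assumes "inj_on h W" "E \<subseteq> W \<times> W" "v \<in> W"
  shows "ht (h ` W) (map_prod h h ` E) (h v) = ht W E v"
proof -
  have "(\<exists>r\<in>roots (h ` W) (map_prod h h ` E). (r, h v) \<in> (map_prod h h ` E) ^^ m) \<longleftrightarrow>
        (\<exists>r\<in>roots W E. (r, v) \<in> E ^^ m)" for m
  proof -
    have "(h r, h v) \<in> (map_prod h h ` E) ^^ m \<longleftrightarrow> (r, v) \<in> E ^^ m" if "r \<in> roots W E" for r
      using that by (intro relpow_map_prod[OF assms(1,2) _ assms(3)]) (simp add: roots_def)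
    then show ?thesis
      unfolding roots_map_prod[OF assms(1,2)] bex_simps(7) by (rule bex_cong[OF refl])
  qed
  then show ?thesis by (simp add: ht_def)
qed

lemma rooted_forest_map_prod:
  assumes inj: "inj_on h W" and E: "rooted_forest W E"
  shows "rooted_forest (h ` W) (map_prod h h ` E)"
proof -
  have sub: "E \<subseteq> W \<times> W" using E by (simp add: rooted_forest_def)
  have "acyclic (map_prod h h ` E)"
  proof (rule acyclicI, rule allI, rule notI)
    fix x assume x: "(x, x) \<in> (map_prod h h ` E)\<^sup>+"
    then have "x \<in> Domain ((map_prod h h ` E)\<^sup>+)" by blast
    then have "x \<in> Domain (map_prod h h ` E)" by simp
    then obtain p where "p \<in> E" "x = h (fst p)" by (auto simp: image_iff)
    with sub obtain u where u: "u \<in> W" "x = h u" by (cases p) auto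
    from x obtain m where "m > 0" "(h u, h u) \<in> (map_prod h h ` E) ^^ m"
      unfolding trancl_power u(2) by blast
    then have "(u, u) \<in> E\<^sup>+"
      unfolding trancl_power relpow_map_prod[OF inj sub u(1) u(1)] by blast
    with E show False by (simp add: rooted_forest_def acyclic_def)
  qed
  moreover have "map_prod h h ` E \<subseteq> h ` W \<times> h ` W" using sub by auto
  moreover have "x = x'" if x: "(x, y) \<in> map_prod h h ` E" "(x', y) \<in> map_prod h h ` E" for x x' y
  proof -
    from x(1) obtain u v where 1: "(u, v) \<in> E" "x = h u" "y = h v" by auto
    from x(2) obtain u' v' where 2: "(u', v') \<in> E" "x' = h u'" "y = h v'" by auto
    have "h v = h v'" using 1(3) 2(3) by simp
    moreover have "v \<in> W" "v' \<in> W" using sub 1(1) 2(1) by auto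
    ultimately have "v = v'" by (rule inj_onD[OF inj])
    with 1(1) 2(1) E have "u = u'" unfolding rooted_forest_def by blast
    with 1(2) 2(2) show ?thesis by simp
  qed
  ultimately show ?thesis
    unfolding rooted_forest_def by (intro conjI allI impI)
qed

lemma forests_relabel:
  fixes g :: "'v \<Rightarrow> 'w"
  assumes inj: "inj_on g V" and \<kappa>: "\<And>v. v \<in> V \<Longrightarrow> \<kappa>' (g v) = \<kappa> v"
    and E: "E \<in> forests n k V \<kappa>"
  defines "h \<equiv> map_sum id g"
  shows "map_prod h h ` E \<in> forests n k (g ` V) \<kappa>'"
    and "forest_weight \<phi> n (g ` V) (map_prod h h ` E) = forest_weight \<phi> n V E"
proof -
  let ?W = "vertices n V"
  have W: "vertices n (g ` V) = h ` ?W"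
    by (auto simp: vertices_def h_def image_Un image_image)
  have injh: "inj_on h ?W"
  proof (rule inj_onI)
    fix x y assume xy: "x \<in> ?W" "y \<in> ?W" "h x = h y"
    show "x = y"
    proof (cases x; cases y)
      fix v w assume vw: "x = Inr v" "y = Inr w"
      with xy have "g v = g w" "v \<in> V" "w \<in> V" by (auto simp: vertices_def h_def)
      with vw show ?thesis using inj_onD[OF inj] by simp
    qed (use xy in \<open>simp_all add: h_def\<close>)
  qed
  have sub: "E \<subseteq> ?W \<times> ?W" using E by (simp add: forests_def rooted_forest_def)
  have hl: "h (Inl i) = Inl i" and hr: "h (Inr v) = Inr (g v)" for i v by (simp_all add: h_def)
  have inr: "Inr v \<in> ?W" if "v \<in> V" for v using that by (simp add: vertices_def)
  have injr: "inj_on h (roots ?W E)"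
    by (rule inj_on_subset[OF injh]) (auto simp: roots_def)
  have rf: "rooted_forest ?W E" using E by (simp add: forests_def)
  show "map_prod h h ` E \<in> forests n k (g ` V) \<kappa>'"
    unfolding forests_def W
  proof (intro CollectI conjI ballI allI impI)
    show "rooted_forest (h ` ?W) (map_prod h h ` E)"
      using injh rf by (rule rooted_forest_map_prod)
    show "card (roots (h ` ?W) (map_prod h h ` E)) = k"
      using E by (simp add: roots_map_prod[OF injh sub] card_image[OF injr] forests_def)
    have "roots ?W E \<subseteq> Inl ` {1..n}" using E by (simp add: forests_def)
    then show "roots (h ` ?W) (map_prod h h ` E) \<subseteq> Inl ` {1..n}"
      by (auto simp: roots_map_prod[OF injh sub] hl)
  next
    fix w assume "w \<in> g ` V"
    then obtain v where v: "v \<in> V" "w = g v" by auto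
    have "children E (Inr v) = {}" using E v by (simp add: forests_def)
    then show "children (map_prod h h ` E) (Inr w) = {}"
      using children_map_prod[OF injh sub inr[OF v(1)]] v by (simp add: hr)
    have "ht ?W E (Inr v) = \<kappa> v" using E v by (simp add: forests_def)
    then show "ht (h ` ?W) (map_prod h h ` E) (Inr w) = \<kappa>' w"
      using ht_map_prod[OF injh sub inr[OF v(1)]] v \<kappa> by (simp add: hr)
  next
    fix i j assume "(Inl i, Inl j) \<in> map_prod h h ` E"
    then obtain a b where ab: "(a, b) \<in> E" "h a = Inl i" "h b = Inl j"
      by (elim imageE) (auto simp: prod_eq_iff)
    have "a = Inl i" using ab(2) by (cases a) (simp_all add: h_def)
    moreover have "b = Inl j" using ab(3) by (cases b) (simp_all add: h_def)
    ultimately show "i < j" using ab(1) E by (simp add: forests_def)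
  qed
  show "forest_weight \<phi> n (g ` V) (map_prod h h ` E) = forest_weight \<phi> n V E"
    unfolding forest_weight_def
  proof (rule prod.cong[OF refl])
    fix i assume "i \<in> {1..n}"
    then have iW: "Inl i \<in> ?W" by (simp add: vertices_def)
    have "card (children (map_prod h h ` E) (Inl i)) = card (children E (Inl i))"
    proof -
      have "inj_on h (children E (Inl i))"
        by (rule inj_on_subset[OF injh]) (use sub in \<open>auto simp: children_def\<close>)
      then show ?thesis
        using children_map_prod[OF injh sub iW] by (simp add: hl card_image)
    qed
    moreover have "ht (vertices n (g ` V)) (map_prod h h ` E) (Inl i) = ht ?W E (Inl i)"
      using ht_map_prod[OF injh sub iW] by (simp add: hl W)
    ultimately show "qconst (\<phi> (card (children (map_prod h h ` E) (Inl i)))) *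
          qvar (ht (vertices n (g ` V)) (map_prod h h ` E) (Inl i)) =
        qconst (\<phi> (card (children E (Inl i)))) * qvar (ht (vertices n V) E (Inl i))"
      by simp
  qed
qed

lemma map_prod_image_inverse:
  assumes "E \<subseteq> W \<times> W" "\<And>w. w \<in> W \<Longrightarrow> h' (h w) = w"
  shows "map_prod h' h' ` map_prod h h ` E = E"
proof -
  have "map_prod h' h' (map_prod h h p) = p" if "p \<in> E" for p
    using assms that by (cases p) auto
  then have "(\<lambda>p. map_prod h' h' (map_prod h h p)) ` E = (\<lambda>p. p) ` E"
    by (rule image_cong[OF refl])
  then show ?thesis by (simp only: image_image image_ident)
qed

lemma forest_sum_relabel:
  assumes g: "bij_betw g V V'" and \<kappa>: "\<And>v. v \<in> V \<Longrightarrow> \<kappa>' (g v) = \<kappa> v"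
  shows "forest_sum \<phi> n k V \<kappa> = forest_sum \<phi> n k V' \<kappa>'"
proof -
  define g' where "g' = inv_into V g"
  have g': "bij_betw g' V' V" and g'g: "\<And>v. v \<in> V \<Longrightarrow> g' (g v) = v"
    and gg': "\<And>v. v \<in> V' \<Longrightarrow> g (g' v) = v"
    using g by (auto simp: g'_def bij_betw_inv_into bij_betw_inv_into_left bij_betw_inv_into_right)
  have \<kappa>': "\<kappa> (g' v) = \<kappa>' v" if "v \<in> V'" for v
    using \<kappa>[of "g' v"] gg'[OF that] g' that by (auto simp: bij_betw_def)
  have V': "g ` V = V'" and V: "g' ` V' = V" and inj: "inj_on g V" and inj': "inj_on g' V'"
    using g g' by (auto simp: bij_betw_def)
  let ?h = "map_sum id g" and ?h' = "map_sum id g'"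
  have inv: "map_prod ?h' ?h' ` map_prod ?h ?h ` E = E" if "E \<in> forests n k V \<kappa>" for E
    by (rule map_prod_image_inverse[of _ "vertices n V"])
       (use that g'g in \<open>auto simp: forests_def rooted_forest_def vertices_def\<close>)
  have inv': "map_prod ?h ?h ` map_prod ?h' ?h' ` E = E" if "E \<in> forests n k V' \<kappa>'" for E
    by (rule map_prod_image_inverse[of _ "vertices n V'"])
       (use that gg' in \<open>auto simp: forests_def rooted_forest_def vertices_def\<close>)
  show ?thesis unfolding forest_sum_def
  proof (rule sum.reindex_bij_witness[of _ "\<lambda>E. map_prod ?h' ?h' ` E" "\<lambda>E. map_prod ?h ?h ` E"])
    fix E assume E: "E \<in> forests n k V \<kappa>"
    show "map_prod ?h' ?h' ` map_prod ?h ?h ` E = E" using E by (rule inv)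
    show "map_prod ?h ?h ` E \<in> forests n k V' \<kappa>'"
      using forests_relabel(1)[OF inj \<kappa> E] V' by simp
    show "forest_weight \<phi> n V' (map_prod ?h ?h ` E) = forest_weight \<phi> n V E"
      using forests_relabel(2)[OF inj \<kappa> E] V' by simp
  next
    fix E assume E: "E \<in> forests n k V' \<kappa>'"
    show "map_prod ?h ?h ` map_prod ?h' ?h' ` E = E" using E by (rule inv')
    show "map_prod ?h' ?h' ` E \<in> forests n k V \<kappa>"
      using forests_relabel(1)[OF inj' \<kappa>' E] V by simp
  qed
qed

lemma bij_betw_fibres:
  assumes fin: "finite V" "finite V'" and \<kappa>: "\<kappa> ` V \<subseteq> I" "\<kappa>' ` V' \<subseteq> I"
    and card: "\<And>i. i \<in> I \<Longrightarrow> card {v \<in> V. \<kappa> v = i} = card {v \<in> V'. \<kappa>' v = i}"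
  shows "\<exists>g. bij_betw g V V' \<and> (\<forall>v\<in>V. \<kappa>' (g v) = \<kappa> v)"
proof -
  have "\<exists>g. bij_betw g {v \<in> V. \<kappa> v = i} {v \<in> V'. \<kappa>' v = i}" if "i \<in> I" for i
    using fin card[OF that] by (intro finite_same_card_bij) auto
  then obtain G where G: "\<And>i. i \<in> I \<Longrightarrow> bij_betw (G i) {v \<in> V. \<kappa> v = i} {v \<in> V'. \<kappa>' v = i}"
    by metis
  define g where "g v = G (\<kappa> v) v" for v
  have gV: "g v \<in> V' \<and> \<kappa>' (g v) = \<kappa> v" if "v \<in> V" for v
  proof -
    have "v \<in> {w \<in> V. \<kappa> w = \<kappa> v}" using that by simp
    then have "G (\<kappa> v) v \<in> {w \<in> V'. \<kappa>' w = \<kappa> v}"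
      using G[of "\<kappa> v"] \<kappa>(1) that unfolding bij_betw_def by blast
    then show ?thesis by (simp add: g_def)
  qed
  have "inj_on g V"
  proof (rule inj_onI)
    fix v w assume vw: "v \<in> V" "w \<in> V" "g v = g w"
    then have eq: "\<kappa> v = \<kappa> w" using gV by metis
    have "inj_on (G (\<kappa> v)) {u \<in> V. \<kappa> u = \<kappa> v}"
      using G[of "\<kappa> v"] \<kappa>(1) vw unfolding bij_betw_def by blast
    then show "v = w" by (rule inj_onD) (use vw eq in \<open>auto simp: g_def\<close>)
  qed
  moreover have "V' \<subseteq> g ` V"
  proof
    fix w assume w: "w \<in> V'"
    then have "w \<in> G (\<kappa>' w) ` {v \<in> V. \<kappa> v = \<kappa>' w}"
      using G[of "\<kappa>' w"] \<kappa>(2) unfolding bij_betw_def by blast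
    then obtain v where "v \<in> V" "\<kappa> v = \<kappa>' w" "w = G (\<kappa>' w) v" by blast
    then have "w = g v" by (simp add: g_def)
    with \<open>v \<in> V\<close> show "w \<in> g ` V" by blast
  qed
  ultimately show ?thesis using gV by (auto simp: bij_betw_def intro!: exI[of _ g])
qed

lemma Bser_coeff:
  fixes V :: "'v set"
  assumes \<iota>: "rat_embedding \<iota>"
    and e: "Poly_Mapping.keys e \<subseteq> {1..n}"
    and V: "finite V" "\<kappa> ` V \<subseteq> {1..n}"
    and card: "\<And>i. i \<in> {1..n} \<Longrightarrow> card {v \<in> V. \<kappa> v = i} = Poly_Mapping.lookup e i"
  shows "qconst (\<iota> (exp_fact e)) * mps_coeff (Bser \<iota> \<phi> n k) e = forest_sum \<phi> n k V \<kappa>"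
proof -
  have leaf: "leaf_set n e = (SIGMA i:{1..n}. {..<Poly_Mapping.lookup e i})"
    by (auto simp: leaf_set_def)
  have fibre: "card {v \<in> leaf_set n e. fst v = i} = Poly_Mapping.lookup e i" if "i \<in> {1..n}" for i
  proof -
    have "{v \<in> leaf_set n e. fst v = i} = Pair i ` {..<Poly_Mapping.lookup e i}"
      using that by (auto simp: leaf_set_def)
    then show ?thesis by (simp add: card_image inj_on_def)
  qed
  have "\<exists>g. bij_betw g (leaf_set n e) V \<and> (\<forall>v\<in>leaf_set n e. \<kappa> (g v) = fst v)"
    by (rule bij_betw_fibres[where I = "{1..n}"]) (use V card fibre in \<open>auto simp: leaf\<close>)
  then obtain g where "bij_betw g (leaf_set n e) V" "\<And>v. v \<in> leaf_set n e \<Longrightarrow> \<kappa> (g v) = fst v"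
    by blast
  then have sum: "forest_sum \<phi> n k (leaf_set n e) fst = forest_sum \<phi> n k V \<kappa>"
    by (rule forest_sum_relabel)
  have "exp_fact e * (1 / exp_fact e) = 1" by (simp add: exp_fact_def)
  then have "\<iota> (exp_fact e) * \<iota> (1 / exp_fact e) = 1"
    using \<iota> unfolding rat_embedding_def by metis
  then have "qconst (\<iota> (exp_fact e)) * qconst (\<iota> (1 / exp_fact e)) = 1"
    by (simp add: qconst_def mult_single)
  then show ?thesis using e by (simp add: Bser_def sum mult.assoc[symmetric])
qed

end

(* The largest internal vertex n has only leaves below it, so every forest arises by adding n to a
   forest on the remaining internal vertices: either as a new root, whose children are leaves of
   height 1, or in place of a leaf of some height i, its children then being leaves of height i + 1.
   The factor phi(x_{i+1}) accounts for the choice of these children, the derivative in x_i for the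
   choice of the replaced leaf.  Starting from B_{0,0} = 1, the case n = 1 needs no separate argument. *)

theory Submission
  imports Defs
begin

section \<open>Coefficients of products\<close>

text \<open>Heights and child counts are awkward to follow through sets of edges, so forests are
  encoded by parent maps: each internal vertex picks a smaller label (0 for a root), each leaf picks
  an internal label, and every such choice is acyclic. Height then becomes a recursion on labels.
  Deleting a vertex that is not a root would lower the child count of its parent and spoil the
  parent's weight. Putting a leaf in its place keeps that count, and prescribing the height
  \<open>i\<close> of this leaf fixes the height of the removed vertex, hence its factor
  \<open>q_i\<close>. The leaf set changes under this operation, even in its type, which is harmless
  because a coefficient depends only on the fibre sizes of the height map. Coefficients are compared
  after multiplication by \<open>exp_fact e\<close>: this turns them into plain forest sums, the
  choice of children among the leaves of one height into a binomial coefficient, and the derivative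
  into a shift of the exponent.\<close>

lemma mps_coeff_mps_of_fps_mult:
  "mps_coeff (mps_of_fps i f * g) e =
     (\<Sum>j\<le>Poly_Mapping.lookup e i. fps_nth f j * mps_coeff g (e - Poly_Mapping.single i j))"
proof -
  let ?S = "{(a, b). (a, b) \<in> splits e \<and> Poly_Mapping.keys a \<subseteq> {i}}"
  have single: "a = Poly_Mapping.single i (Poly_Mapping.lookup a i)"
    if "Poly_Mapping.keys a \<subseteq> {i}" for a :: "nat \<Rightarrow>\<^sub>0 nat"
    using that by (intro poly_mapping_eqI) (auto simp: lookup_single when_def in_keys_iff)
  have "mps_coeff (mps_of_fps i f * g) e =
      (\<Sum>(a, b)\<in>?S. fps_nth f (Poly_Mapping.lookup a i) * mps_coeff g b)"
    unfolding times_mps.rep_eq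
    by (rule sum.mono_neutral_cong_right) (auto simp: mps_of_fps_def split: if_split_asm)
  also have "\<dots> =
      (\<Sum>j\<le>Poly_Mapping.lookup e i. fps_nth f j * mps_coeff g (e - Poly_Mapping.single i j))"
  proof (rule sum.reindex_bij_witness[of _ "\<lambda>j. (Poly_Mapping.single i j, e - Poly_Mapping.single i j)"
        "\<lambda>(a, b). Poly_Mapping.lookup a i"], goal_cases)
    case (1 p)
    then obtain a b where p: "p = (a, b)" "a + b = e" "Poly_Mapping.keys a \<subseteq> {i}"
      by (auto simp: splits_def)
    have "e - a = b" using p(2) by auto
    then show ?case using p(1) single[OF p(3)] by simp
  next
    case (2 p)
    then show ?case by (auto simp: splits_def lookup_add)
  next
    case (3 j)
    then show ?case by simp
  next
    case (4 j)
    \<comment> \<open>Subtraction of exponents is truncated; the bound on \<open>j\<close> makes it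
      exact here.\<close>
    have "Poly_Mapping.single i j + (e - Poly_Mapping.single i j) = e"
      using 4 by (intro poly_mapping_eqI)
        (auto simp: lookup_add lookup_minus lookup_single when_def)
    then show ?case by (auto simp: splits_def)
  next
    case (5 p)
    then obtain a b where p: "p = (a, b)" "a + b = e" "Poly_Mapping.keys a \<subseteq> {i}"
      by (auto simp: splits_def)
    have "e - a = b" using p(2) by auto
    then show ?case using p(1) single[OF p(3)] by simp
  qed
  finally show ?thesis .
qed

lemma mps_coeff_const_mult: "mps_coeff (mps_const c * f) e = c * mps_coeff f e"
proof -
  \<comment> \<open>A constant is a univariate series in any variable, so the product formula above
    applies; the index 0 is an arbitrary choice.\<close>
  have "mps_const c = mps_of_fps 0 (fps_const c)"
  proof (rule mps_eqI)
    fix a :: "nat \<Rightarrow>\<^sub>0 nat"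
    have "a = 0 \<longleftrightarrow> Poly_Mapping.keys a \<subseteq> {0} \<and> Poly_Mapping.lookup a 0 = 0"
      by (auto simp: poly_mapping_eq_iff fun_eq_iff in_keys_iff subset_iff)
    then show "mps_coeff (mps_const c) a = mps_coeff (mps_of_fps 0 (fps_const c)) a"
      by (auto simp: mps_const_def mps_of_fps_def)
  qed
  then have "mps_coeff (mps_const c * f) e =
      (\<Sum>j\<le>Poly_Mapping.lookup e 0. if j = 0 then c * mps_coeff f (e - Poly_Mapping.single 0 j) else 0)"
    by (simp only: mps_coeff_mps_of_fps_mult) (intro sum.cong, auto)
  then show ?thesis by simp
qed

lemma mps_coeff_sum: "mps_coeff (sum f A) e = (\<Sum>x\<in>A. mps_coeff (f x) e)"
  by (induction A rule: infinite_finite_induct) (simp_all add: zero_mps.rep_eq plus_mps.rep_eq)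

section \<open>Factorials of exponents\<close>

lemma exp_fact_superset:
  assumes "finite S" "Poly_Mapping.keys e \<subseteq> S"
  shows "exp_fact e = (\<Prod>i\<in>S. fact (Poly_Mapping.lookup e i))"
  unfolding exp_fact_def using assms by (intro prod.mono_neutral_left) (auto simp: in_keys_iff)

text \<open>Only the factor at \<open>i\<close> changes. The cross-multiplied form serves both the
  product with \<phi>, where \<open>j\<close> children are split off, and the derivative, where
  \<open>j = 1\<close>.\<close>

lemma exp_fact_add_single:
  "exp_fact (a + Poly_Mapping.single i j) * fact (Poly_Mapping.lookup a i) =
   exp_fact a * fact (Poly_Mapping.lookup a i + j)"
proof -
  let ?S = "insert i (Poly_Mapping.keys a)"
  have keys: "Poly_Mapping.keys (a + Poly_Mapping.single i j) \<subseteq> ?S"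
    by (auto simp: in_keys_iff lookup_add lookup_single when_def split: if_splits)
  have "exp_fact a = fact (Poly_Mapping.lookup a i) *
      (\<Prod>m\<in>?S - {i}. fact (Poly_Mapping.lookup a m))"
    by (subst exp_fact_superset[of ?S]) (auto simp: prod.remove[of ?S i])
  moreover have "exp_fact (a + Poly_Mapping.single i j) = fact (Poly_Mapping.lookup a i + j) *
      (\<Prod>m\<in>?S - {i}. fact (Poly_Mapping.lookup a m))"
    by (subst exp_fact_superset[OF _ keys], simp, subst prod.remove[of ?S i])
       (auto simp: lookup_add lookup_single when_def intro!: prod.cong)
  ultimately show ?thesis by simp
qed

lemma exp_fact_nonzero: "exp_fact e \<noteq> 0"
  by (simp add: exp_fact_def)


section \<open>Scalars\<close>

lemma qconst_rat_hom:
  assumes "rat_embedding \<iota>"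
  shows "qconst (\<iota> (a * b)) = qconst (\<iota> a) * qconst (\<iota> b)"
    and "qconst (\<iota> 1) = 1"
    and "qconst (\<iota> (of_nat m)) = of_nat m"
proof -
  have add: "\<iota> (a + b) = \<iota> a + \<iota> b" and mult: "\<iota> (a * b) = \<iota> a * \<iota> b" and one: "\<iota> 1 = 1" for a b
    using assms by (auto simp: rat_embedding_def)
  show "qconst (\<iota> (a * b)) = qconst (\<iota> a) * qconst (\<iota> b)"
    by (simp add: qconst_def mult mult_single)
  show one': "qconst (\<iota> 1) = 1" by (simp add: qconst_def one)
  have zero: "\<iota> 0 = 0" using add[of 0 0] by simp
  show "qconst (\<iota> (of_nat m)) = of_nat m"
  proof (induction m)
    case 0
    then show ?case by (simp add: qconst_def zero)
  next
    case (Suc m)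
    then show ?case using one' by (simp add: qconst_def add single_add)
  qed
qed

lemma qconst_mult: "qconst (a * b) = qconst a * qconst b"
  by (simp add: qconst_def mult_single)

text \<open>A nonzero rational maps to a unit, so two series agree as soon as their coefficients
  agree after denominators have been cleared by \<open>exp_fact e\<close>.\<close>

lemma exp_fact_cancel:
  assumes "rat_embedding \<iota>" "qconst (\<iota> (exp_fact e)) * x = qconst (\<iota> (exp_fact e)) * y"
  shows "x = y"
proof -
  have *: "qconst (\<iota> (1 / exp_fact e)) * qconst (\<iota> (exp_fact e)) = 1"
    by (simp flip: qconst_rat_hom(1)[OF assms(1)]
          add: exp_fact_nonzero qconst_rat_hom(2)[OF assms(1)])
  have "qconst (\<iota> (1 / exp_fact e)) * (qconst (\<iota> (exp_fact e)) * x) =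
      qconst (\<iota> (1 / exp_fact e)) * (qconst (\<iota> (exp_fact e)) * y)"
    using assms(2) by simp
  then show ?thesis by (simp add: * flip: mult.assoc)
qed

text \<open>Grouping subsets by size is the link between the combinatorial sum over sets of children
  and the coefficients of \<phi>.\<close>

lemma sum_Pow_card:
  fixes g :: "nat \<Rightarrow> 'b::comm_semiring_1"
  assumes "finite A"
  shows "(\<Sum>J\<in>Pow A. g (card J)) = (\<Sum>j\<le>card A. of_nat (card A choose j) * g j)"
proof -
  have "(\<Sum>J\<in>Pow A. g (card J)) = (\<Sum>j\<le>card A. \<Sum>J\<in>{J \<in> Pow A. card J = j}. g (card J))"
    by (rule sum.group[symmetric]) (use assms in \<open>auto intro: card_mono\<close>)
  also have "\<dots> = (\<Sum>j\<le>card A. of_nat (card A choose j) * g j)"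
  proof (rule sum.cong[OF refl])
    fix j
    have "(\<Sum>J\<in>{J \<in> Pow A. card J = j}. g (card J)) = (\<Sum>J\<in>{J. J \<subseteq> A \<and> card J = j}. g j)"
      by (rule sum.cong) auto
    then show "(\<Sum>J\<in>{J \<in> Pow A. card J = j}. g (card J)) = of_nat (card A choose j) * g j"
      by (simp add: n_subsets[OF assms])
  qed
  finally show ?thesis .
qed


section \<open>Parent maps\<close>

text \<open>
  A parent map sends an internal vertex to the label of its parent, with \<open>0\<close> standing for a
  virtual vertex above all roots.
\<close>

fun depth :: "(nat \<Rightarrow> nat) \<Rightarrow> nat \<Rightarrow> nat" where
  "depth p i = (if p i < i then Suc (depth p (p i)) else 0)"

declare depth.simps [simp del]

lemma depth_0 [simp]: "depth p 0 = 0"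
  by (simp add: depth.simps)

lemma depth_less: "p i < i \<Longrightarrow> depth p i = Suc (depth p (p i))"
  by (subst depth.simps) simp

lemma depth_le: "depth p i \<le> i"
proof (induction i rule: less_induct)
  case (less i)
  show ?case
  proof (cases "p i < i")
    case True
    with less.IH[of "p i"] show ?thesis by (simp add: depth_less)
  next
    case False
    then show ?thesis by (subst depth.simps) simp
  qed
qed

lemma depth_cong: "(\<And>j. 1 \<le> j \<Longrightarrow> j \<le> i \<Longrightarrow> p j = p' j) \<Longrightarrow> depth p i = depth p' i"
proof (induction i rule: less_induct)
  case (less i)
  show ?case
  proof (cases "1 \<le> i \<and> p i < i")
    case True
    then have eq: "p i = p' i" by (intro less.prems) auto
    have "depth p (p i) = depth p' (p i)"
      using True by (intro less.IH less.prems) auto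
    with True eq show ?thesis by (simp add: depth_less)
  next
    case False
    \<comment> \<open>Nothing is assumed about the values at 0, but there the guard fails for both
      maps anyway.\<close>
    have "\<not> p i < i \<and> \<not> p' i < i"
    proof (cases "i = 0")
      case False
      then have "p i = p' i" by (intro less.prems) auto
      with False \<open>\<not> (1 \<le> i \<and> p i < i)\<close> show ?thesis by simp
    qed simp
    then show ?thesis by (subst (1 2) depth.simps) simp
  qed
qed

text \<open>Acyclicity and increasing labels are built into the ranges: a parent has a smaller
  label. Leaves cannot take the value 0, since all roots are internal. Extensionality makes the set
  finite and the encoding unique.\<close>

definition parent_funs :: "nat \<Rightarrow> 'v set \<Rightarrow> (nat + 'v \<Rightarrow> nat) set" where
  "parent_funs n V = PiE (vertices n V) (case_sum (\<lambda>i. {..<i}) (\<lambda>_. {1..n}))"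

definition parent_maps :: "nat \<Rightarrow> nat \<Rightarrow> 'v set \<Rightarrow> ('v \<Rightarrow> nat) \<Rightarrow> (nat + 'v \<Rightarrow> nat) set" where
  "parent_maps n k V \<kappa> = {F \<in> parent_funs n V.
     card {i \<in> {1..n}. F (Inl i) = 0} = k \<and>
     (\<forall>v\<in>V. depth (F \<circ> Inl) (F (Inr v)) = \<kappa> v)}"

definition parent_weight ::
    "(nat \<Rightarrow> 'a::comm_ring_1) \<Rightarrow> nat \<Rightarrow> 'v set \<Rightarrow> (nat + 'v \<Rightarrow> nat) \<Rightarrow> 'a qpoly" where
  "parent_weight \<phi> n V F = (\<Prod>i\<in>{1..n}.
     qconst (\<phi> (card {w \<in> vertices n V. F w = i})) * qvar (depth (F \<circ> Inl) (F (Inl i))))"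

definition parent_edges :: "nat \<Rightarrow> 'v set \<Rightarrow> (nat + 'v \<Rightarrow> nat) \<Rightarrow> ((nat + 'v) \<times> (nat + 'v)) set" where
  "parent_edges n V F = {(Inl (F w), w) | w. w \<in> vertices n V \<and> F w \<noteq> 0}"

lemma Inl_in_vertices [simp]: "Inl i \<in> vertices n V \<longleftrightarrow> 1 \<le> i \<and> i \<le> n"
  and Inr_in_vertices [simp]: "Inr v \<in> vertices n V \<longleftrightarrow> v \<in> V"
  by (auto simp: vertices_def)

lemma parent_funs_iff:
  "F \<in> parent_funs n V \<longleftrightarrow>
     (\<forall>i. 1 \<le> i \<longrightarrow> i \<le> n \<longrightarrow> F (Inl i) < i) \<and> (\<forall>v\<in>V. 1 \<le> F (Inr v) \<and> F (Inr v) \<le> n) \<and>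
     F \<in> extensional (vertices n V)"
proof -
  have "F \<in> parent_funs n V \<longleftrightarrow>
      (\<forall>w\<in>vertices n V. F w \<in> case_sum (\<lambda>i. {..<i}) (\<lambda>_. {1..n}) w) \<and>
      F \<in> extensional (vertices n V)"
    by (simp only: parent_funs_def PiE_iff)
  also have "(\<forall>w\<in>vertices n V. F w \<in> case_sum (\<lambda>i. {..<i}) (\<lambda>_. {1..n}) w) \<longleftrightarrow>
      (\<forall>i. 1 \<le> i \<longrightarrow> i \<le> n \<longrightarrow> F (Inl i) < i) \<and> (\<forall>v\<in>V. 1 \<le> F (Inr v) \<and> F (Inr v) \<le> n)"
    unfolding vertices_def ball_Un ball_simps sum.case by auto
  finally show ?thesis by simp
qed

lemma finite_vertices: "finite V \<Longrightarrow> finite (vertices n V)"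
  by (simp add: vertices_def)

lemma finite_parent_maps: "finite V \<Longrightarrow> finite (parent_maps n k V \<kappa>)"
proof (rule finite_subset)
  assume "finite V"
  then show "finite (parent_funs n V)"
    unfolding parent_funs_def
    by (intro finite_PiE finite_vertices) (auto split: sum.split)
qed (auto simp: parent_maps_def)

section \<open>Parent maps correspond to forests given by edges\<close>

lemma parent_edges_iff [simp]:
  "(u, w) \<in> parent_edges n V F \<longleftrightarrow> u = Inl (F w) \<and> w \<in> vertices n V \<and> F w \<noteq> 0"
  by (auto simp: parent_edges_def)

lemma roots_parent_edges: "roots (vertices n V) (parent_edges n V F) = {w \<in> vertices n V. F w = 0}"
  by (auto simp: roots_def)

lemma roots_parent_edges_Inl:
  assumes "F \<in> parent_funs n V"
  shows "roots (vertices n V) (parent_edges n V F) = Inl ` {i \<in> {1..n}. F (Inl i) = 0}"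
proof (rule set_eqI)
  fix w
  show "w \<in> roots (vertices n V) (parent_edges n V F) \<longleftrightarrow> w \<in> Inl ` {i \<in> {1..n}. F (Inl i) = 0}"
  proof (cases w)
    case (Inr v)
    have "F (Inr v) \<noteq> 0" if "v \<in> V" using assms that by (auto simp: parent_funs_iff)
    then show ?thesis by (auto simp: roots_parent_edges Inr)
  qed (auto simp: roots_parent_edges)
qed

lemma parent_in_vertices:
  assumes "F \<in> parent_funs n V" "w \<in> vertices n V" "F w \<noteq> 0"
  shows "Inl (F w) \<in> (vertices n V :: (nat + 'v) set)"
  using assms by (cases w) (force simp: parent_funs_iff)+

text \<open>Since parents are unique, a walk from a root to \<open>w\<close> can have only one
  length, so the \<open>LEAST\<close> in \<open>ht\<close> is taken over a single value. The
  induction on this length removes the last edge, whose source is the parent of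
  \<open>w\<close>.\<close>

lemma ht_parent_edges:
  assumes F: "F \<in> parent_funs n V" and w: "w \<in> vertices n V"
  shows "ht (vertices n V) (parent_edges n V F) w = depth (F \<circ> Inl) (F w)"
proof -
  let ?E = "parent_edges n V F"
  define p where "p = F \<circ> Inl"
  have p_apply: "p i = F (Inl i)" for i by (simp add: p_def)
  have lt: "F (Inl i) < i" if "1 \<le> i" "i \<le> n" for i using F that by (simp add: parent_funs_iff)
  have "(\<exists>r\<in>roots (vertices n V) ?E. (r, w) \<in> ?E ^^ m) \<longleftrightarrow> m = depth p (F w)"
    if "w \<in> vertices n V" for m w
    using that
  proof (induction m arbitrary: w)
    case 0
    have "0 = depth p (F w) \<longleftrightarrow> F w = 0"
    proof (cases "F w = 0")
      case False
      with parent_in_vertices[OF F 0] lt have "F (Inl (F w)) < F w" by auto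
      with False show ?thesis by (simp add: depth_less p_apply)
    qed simp
    moreover have "(\<exists>r\<in>roots (vertices n V) ?E. (r, w) \<in> ?E ^^ 0) \<longleftrightarrow> F w = 0"
      using 0 by (auto simp: roots_parent_edges)
    ultimately show ?case by simp
  next
    case (Suc m)
    have "(\<exists>r\<in>roots (vertices n V) ?E. (r, w) \<in> ?E ^^ Suc m) \<longleftrightarrow>
        F w \<noteq> 0 \<and> (\<exists>r\<in>roots (vertices n V) ?E. (r, Inl (F w)) \<in> ?E ^^ m)"
      using Suc.prems by (auto simp: relcomp_unfold)
    also have "\<dots> \<longleftrightarrow> Suc m = depth p (F w)"
    proof (cases "F w = 0")
      case False
      with parent_in_vertices[OF F Suc.prems] lt have "F (Inl (F w)) < F w" by auto
      then have "p (F w) < F w" by (simp only: p_apply)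
      then have "depth p (F w) = Suc (depth p (F (Inl (F w))))" by (simp only: depth_less p_apply)
      with False Suc.IH[OF parent_in_vertices[OF F Suc.prems False]] show ?thesis by simp
    qed simp
    finally show ?case .
  qed
  then show ?thesis using w by (auto simp: ht_def p_def intro: Least_equality)
qed

lemma children_parent_edges:
  "1 \<le> i \<Longrightarrow> children (parent_edges n V F) (Inl i) = {w \<in> vertices n V. F w = i}"
  by (auto simp: children_def)

lemma parent_edges_in_forests:
  assumes F: "F \<in> parent_maps n k V \<kappa>"
  shows "parent_edges n V F \<in> forests n k V \<kappa>"
proof -
  let ?E = "parent_edges n V F" and ?W = "vertices n V"
  have F': "F \<in> parent_funs n V" using F by (simp add: parent_maps_def)
  have "?E \<subseteq> ?W \<times> ?W"
  proof (rule subrelI)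
    fix u w assume "(u, w) \<in> ?E"
    with parent_in_vertices[OF F', of w] show "(u, w) \<in> ?W \<times> ?W" by simp
  qed
  moreover have "acyclic ?E"
  proof (rule wf_acyclic, rule wf_subset[OF wf_measure])
    \<comment> \<open>Leaves receive \<open>Suc n\<close>, a value above all internal labels, so
      that the measure also grows along edges into leaves.\<close>
    show "?E \<subseteq> measure (case_sum id (\<lambda>_. Suc n))"
    proof (rule subrelI)
      fix u w assume "(u, w) \<in> ?E"
      with F' show "(u, w) \<in> measure (case_sum id (\<lambda>_. Suc n))"
        by (cases w) (auto simp: parent_funs_iff less_Suc_eq_le)
    qed
  qed
  ultimately have "rooted_forest ?W ?E" by (auto simp: rooted_forest_def)
  moreover have roots: "roots ?W ?E = Inl ` {i \<in> {1..n}. F (Inl i) = 0}"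
    using F' by (rule roots_parent_edges_Inl)
  then have "card (roots ?W ?E) = k"
    using F by (simp add: card_image parent_maps_def)
  moreover have "\<forall>v\<in>V. ht ?W ?E (Inr v) = \<kappa> v"
    using F by (simp add: ht_parent_edges[OF F'] parent_maps_def)
  moreover have "\<forall>i j. (Inl i, Inl j) \<in> ?E \<longrightarrow> i < j"
    using F' by (auto simp: parent_funs_iff)
  ultimately show ?thesis
    unfolding forests_def by (auto simp: roots children_def)
qed

lemma forest_weight_parent_edges:
  assumes "F \<in> parent_maps n k V \<kappa>"
  shows "forest_weight \<phi> n V (parent_edges n V F) = parent_weight \<phi> n V F"
  unfolding forest_weight_def parent_weight_def
  using assms by (intro prod.cong) (auto simp: children_parent_edges ht_parent_edges parent_maps_def)

lemma bij_betw_parent_edges: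
  "bij_betw (parent_edges n V) (parent_maps n k V \<kappa>) (forests n k V \<kappa>)"
proof (rule bij_betwI')
  fix F G assume FG: "F \<in> parent_maps n k V \<kappa>" "G \<in> parent_maps n k V \<kappa>"
  show "parent_edges n V F = parent_edges n V G \<longleftrightarrow> F = G"
  proof
    assume eq: "parent_edges n V F = parent_edges n V G"
    show "F = G"
    proof (rule extensionalityI)
      show "F \<in> extensional (vertices n V)" "G \<in> extensional (vertices n V)"
        using FG by (auto simp: parent_maps_def parent_funs_iff)
      fix w assume w: "w \<in> vertices n V"
      have "(u, w) \<in> parent_edges n V F \<longleftrightarrow> (u, w) \<in> parent_edges n V G" for u using eq by simp
      with w show "F w = G w" by (cases "F w = 0"; cases "G w = 0") auto
    qed
  qed simp
next
  fix F assume "F \<in> parent_maps n k V \<kappa>"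
  then show "parent_edges n V F \<in> forests n k V \<kappa>" by (rule parent_edges_in_forests)
next
  fix E assume E: "E \<in> forests n k V \<kappa>"
  let ?W = "vertices n V"
  have sub: "E \<subseteq> ?W \<times> ?W" and uniq: "\<And>u u' v. (u, v) \<in> E \<Longrightarrow> (u', v) \<in> E \<Longrightarrow> u = u'"
    and roots: "roots ?W E \<subseteq> Inl ` {1..n}" and leaf: "\<And>v. v \<in> V \<Longrightarrow> children E (Inr v) = {}"
    and inc: "\<And>i j. (Inl i, Inl j) \<in> E \<Longrightarrow> i < j"
    using E unfolding forests_def rooted_forest_def by (auto simp del: Inl_in_vertices Inr_in_vertices)
  \<comment> \<open>The description is well defined: parents are unique, and they are internal
    because leaves have no children. Vertices without a parent receive the virtual parent 0.\<close>
  define F where "F = restrict (\<lambda>w. if \<exists>u. (u, w) \<in> E then (THE i. (Inl i, w) \<in> E) else 0) ?W"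
  have parent: "u = Inl (F w) \<and> F w \<noteq> 0" if uw: "(u, w) \<in> E" for u w
  proof -
    have uW: "u \<in> ?W" and wW: "w \<in> ?W" using sub uw by auto
    from uW obtain i where i: "u = Inl i" "i \<noteq> 0"
      using uw leaf by (cases u) (auto simp: children_def)
    have "F w = (THE i. (Inl i, w) \<in> E)" using uw wW by (auto simp: F_def)
    also have "\<dots> = i" using uw i uniq by (intro the_equality) auto
    finally show ?thesis using i by simp
  qed
  have noparent: "F w = 0" if "\<And>u. (u, w) \<notin> E" "w \<in> ?W" for w
    using that by (simp add: F_def)
  have EF: "E = parent_edges n V F"
  proof (rule set_eqI)
    fix p :: "(nat + 'a) \<times> (nat + 'a)"
    obtain u w where p: "p = (u, w)" by (cases p)
    show "p \<in> E \<longleftrightarrow> p \<in> parent_edges n V F"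
    proof
      assume "p \<in> E"
      then show "p \<in> parent_edges n V F" using parent sub p by auto
    next
      assume "p \<in> parent_edges n V F"
      then have w: "w \<in> ?W" "F w \<noteq> 0" "u = Inl (F w)" using p by auto
      then obtain u' where u': "(u', w) \<in> E" using noparent[OF _ w(1)] by metis
      with parent[OF u'] w(3) p show "p \<in> E" by simp
    qed
  qed
  have F: "F \<in> parent_funs n V"
    unfolding parent_funs_iff
  proof (intro conjI allI ballI impI)
    fix i assume i: "1 \<le> i" "i \<le> n"
    show "F (Inl i) < i"
    proof (cases "F (Inl i) = 0")
      case False
      with i EF have "(Inl (F (Inl i)), Inl i) \<in> E" by simp
      then show ?thesis by (rule inc)
    qed (use i in simp)
  next
    fix v assume v: "v \<in> V"
    then have "Inr v \<notin> roots ?W E" using roots by auto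
    then obtain u where "(u, Inr v) \<in> E" using v by (auto simp: roots_def)
    then have "(Inl (F (Inr v)), Inr v) \<in> E" using parent by metis
    then have "Inl (F (Inr v)) \<in> ?W" using sub by auto
    then show "1 \<le> F (Inr v)" "F (Inr v) \<le> n" by auto
  qed (simp add: F_def)
  have "roots ?W E = Inl ` {i \<in> {1..n}. F (Inl i) = 0}"
    unfolding EF using F by (rule roots_parent_edges_Inl)
  then have "card {i \<in> {1..n}. F (Inl i) = 0} = card (roots ?W E)"
    by (simp add: card_image)
  also have "\<dots> = k" using E by (simp add: forests_def)
  finally have "F \<in> parent_maps n k V \<kappa>"
    using E F ht_parent_edges[OF F] by (auto simp: parent_maps_def forests_def simp flip: EF)
  with EF show "\<exists>F\<in>parent_maps n k V \<kappa>. E = parent_edges n V F" by blast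
qed

lemma forest_sum_parent_maps:
  "forest_sum \<phi> n k V \<kappa> = (\<Sum>F\<in>parent_maps n k V \<kappa>. parent_weight \<phi> n V F)"
  unfolding forest_sum_def
  by (subst sum.reindex_bij_betw[OF bij_betw_parent_edges, symmetric])
     (simp add: forest_weight_parent_edges)

section \<open>Degenerate forest sums\<close>

lemma forest_sum_no_roots: "1 \<le> n \<Longrightarrow> forest_sum \<phi> n 0 V \<kappa> = 0"
proof -
  assume n: "1 \<le> n"
  have "parent_maps n 0 V \<kappa> = {}"
  proof (rule equals0I)
    fix F
    assume F: "F \<in> parent_maps n 0 V \<kappa>"
    \<comment> \<open>The vertex 1 has no smaller internal label above it, so it is always a
      root.\<close>
    then have "F (Inl 1) < 1" using n unfolding parent_maps_def parent_funs_iff by blast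
    then have "1 \<in> {i \<in> {1..n}. F (Inl i) = 0}" using n by simp
    with F show False by (auto simp: parent_maps_def)
  qed
  then show ?thesis by (simp add: forest_sum_parent_maps)
qed

lemma forest_sum_many_roots: "n < k \<Longrightarrow> forest_sum \<phi> n k V \<kappa> = 0"
proof -
  assume nk: "n < k"
  have "parent_maps n k V \<kappa> = {}"
  proof (rule equals0I)
    fix F assume "F \<in> parent_maps n k V \<kappa>"
    then have "k = card {i \<in> {1..n}. F (Inl i) = 0}" by (simp add: parent_maps_def)
    also have "\<dots> \<le> card {1..n}" by (rule card_mono) auto
    finally show False using nk by simp
  qed
  then show ?thesis by (simp add: forest_sum_parent_maps)
qed

text \<open>A leaf has an internal parent, so its height is at least 1, and labels increase along
  the path to it, so its height is at most \<open>n\<close>. This matches the support condition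
  built into \<open>Bser\<close>.\<close>

lemma forest_sum_height_range:
  assumes "v \<in> V" "\<kappa> v \<notin> {1..n}"
  shows "forest_sum \<phi> n k V \<kappa> = 0"
proof -
  have "parent_maps n k V \<kappa> = {}"
  proof (rule equals0I)
    fix F
    assume F: "F \<in> parent_maps n k V \<kappa>"
    let ?i = "F (Inr v)"
    have i: "1 \<le> ?i" "?i \<le> n" "depth (F \<circ> Inl) ?i = \<kappa> v"
      using F assms(1) by (auto simp: parent_maps_def parent_funs_iff)
    then have "F (Inl ?i) < ?i" using F by (auto simp: parent_maps_def parent_funs_iff)
    then have "1 \<le> \<kappa> v" using i by (simp add: depth_less)
    with i depth_le[of "F \<circ> Inl" ?i] assms(2) show False by simp
  qed
  then show ?thesis by (simp add: forest_sum_parent_maps)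
qed

lemma forest_sum_empty: "forest_sum \<phi> 0 0 {} \<kappa> = 1"
proof -
  have "parent_maps 0 0 {} \<kappa> = {\<lambda>_. undefined}"
    by (auto simp: parent_maps_def parent_funs_iff vertices_def)
  then show ?thesis by (simp add: forest_sum_parent_maps parent_weight_def)
qed


section \<open>Removing the largest internal vertex\<close>

text \<open>
  The vertex \<open>Suc n\<close>, with parent \<open>d\<close>, is added to the forest \<open>G\<close> and receives the leaves in
  \<open>J\<close> as children.
\<close>

definition attach :: "nat \<Rightarrow> 'v set \<Rightarrow> 'v set \<Rightarrow> nat \<Rightarrow> (nat + 'v \<Rightarrow> nat) \<Rightarrow> nat + 'v \<Rightarrow> nat" where
  "attach n V J d G = restrict (case_sum (\<lambda>i. if i = Suc n then d else G (Inl i))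
     (\<lambda>v. if v \<in> J then Suc n else G (Inr v))) (vertices (Suc n) V)"

lemma attach_Inl: "1 \<le> i \<Longrightarrow> i \<le> n \<Longrightarrow> attach n V J d G (Inl i) = G (Inl i)"
  and attach_last: "attach n V J d G (Inl (Suc n)) = d"
  and attach_Inr: "v \<in> V \<Longrightarrow> attach n V J d G (Inr v) = (if v \<in> J then Suc n else G (Inr v))"
  by (simp_all add: attach_def)

lemma depth_attach: "i \<le> n \<Longrightarrow> depth (attach n V J d G \<circ> Inl) i = depth (G \<circ> Inl) i"
  by (rule depth_cong) (simp add: attach_Inl)

lemma depth_attach_last:
  "d \<le> n \<Longrightarrow> depth (attach n V J d G \<circ> Inl) (Suc n) = Suc (depth (G \<circ> Inl) d)"
  by (subst depth_less) (simp_all add: attach_last depth_attach)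

lemma attach_in_parent_funs:
  assumes "d \<le> n" "G \<in> parent_funs n (V - J)"
  shows "attach n V J d G \<in> parent_funs (Suc n) V"
  unfolding parent_funs_iff
proof (intro conjI allI ballI impI)
  fix i assume "1 \<le> i" "i \<le> Suc n"
  then show "attach n V J d G (Inl i) < i"
    using assms by (cases "i = Suc n") (auto simp: attach_Inl attach_last parent_funs_iff)
next
  fix v assume "v \<in> V"
  then show "1 \<le> attach n V J d G (Inr v)" "attach n V J d G (Inr v) \<le> Suc n"
    using assms by (auto simp: attach_Inr parent_funs_iff le_Suc_eq)
qed (simp add: attach_def)

text \<open>The path upwards from a label at most \<open>n\<close> never meets \<open>Suc n\<close>,
  so depths computed in \<open>G\<close> survive. The leaves in \<open>J\<close> hang from
  \<open>Suc n\<close>, whose depth exceeds that of \<open>d\<close> by one; the root count grows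
  exactly when \<open>d\<close> is the virtual vertex.\<close>

lemma attach_in_parent_maps_iff:
  assumes J: "J \<subseteq> V" and d: "d \<le> n" and G: "G \<in> parent_funs n (V - J)"
  shows "attach n V J d G \<in> parent_maps (Suc n) k V \<kappa> \<longleftrightarrow>
    card {i \<in> {1..n}. G (Inl i) = 0} + (if d = 0 then 1 else 0) = k \<and>
    (\<forall>v\<in>V - J. depth (G \<circ> Inl) (G (Inr v)) = \<kappa> v) \<and>
    (\<forall>v\<in>J. \<kappa> v = Suc (depth (G \<circ> Inl) d))"
proof -
  let ?F = "attach n V J d G"
  have "{i \<in> {1..Suc n}. ?F (Inl i) = 0} =
      {i \<in> {1..n}. G (Inl i) = 0} \<union> (if d = 0 then {Suc n} else {})"
    by (auto simp: attach_Inl attach_last le_Suc_eq)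
  then have "card {i \<in> {1..Suc n}. ?F (Inl i) = 0} =
      card {i \<in> {1..n}. G (Inl i) = 0} + (if d = 0 then 1 else 0)"
    by simp
  moreover have "(\<forall>v\<in>V. depth (?F \<circ> Inl) (?F (Inr v)) = \<kappa> v) \<longleftrightarrow>
      (\<forall>v\<in>V - J. depth (G \<circ> Inl) (G (Inr v)) = \<kappa> v) \<and>
      (\<forall>v\<in>J. \<kappa> v = Suc (depth (G \<circ> Inl) d))"
  proof -
    let ?P = "\<lambda>v. depth (?F \<circ> Inl) (?F (Inr v)) = \<kappa> v"
    have "(\<forall>v\<in>V. ?P v) \<longleftrightarrow> (\<forall>v\<in>V - J. ?P v) \<and> (\<forall>v\<in>J. ?P v)"
      using J by blast
    moreover have "depth (?F \<circ> Inl) (?F (Inr v)) = depth (G \<circ> Inl) (G (Inr v))" if "v \<in> V - J" for v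
      using that G by (simp add: attach_Inr depth_attach parent_funs_iff)
    then have "(\<forall>v\<in>V - J. ?P v) \<longleftrightarrow> (\<forall>v\<in>V - J. depth (G \<circ> Inl) (G (Inr v)) = \<kappa> v)"
      by (intro ball_cong[OF refl]) (simp only:)
    moreover have "?P v \<longleftrightarrow> \<kappa> v = Suc (depth (G \<circ> Inl) d)" if "v \<in> J" for v
      using that J by (auto simp: attach_Inr depth_attach_last[OF d])
    then have "(\<forall>v\<in>J. ?P v) \<longleftrightarrow> (\<forall>v\<in>J. \<kappa> v = Suc (depth (G \<circ> Inl) d))"
      by (rule ball_cong[OF refl])
    ultimately show ?thesis by (simp only:)
  qed
  moreover have "?F \<in> parent_funs (Suc n) V" using d G by (rule attach_in_parent_funs)
  ultimately show ?thesis by (simp only: parent_maps_def mem_Collect_eq simp_thms)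
qed

text \<open>Besides the factor of the new vertex, only the factor of its parent \<open>d\<close>
  changes, by one extra child. The value \<open>d = 0\<close> equals no index of the product, so new
  roots are covered too.\<close>

lemma parent_weight_attach:
  assumes J: "J \<subseteq> V" and d: "d \<le> n" and G: "G \<in> parent_funs n (V - J)" and fin: "finite V"
  shows "parent_weight \<phi> (Suc n) V (attach n V J d G) =
    qconst (\<phi> (card J)) * qvar (depth (G \<circ> Inl) d) *
    (\<Prod>i\<in>{1..n}. qconst (\<phi> (card {w \<in> vertices n (V - J). G w = i} + (if d = i then 1 else 0))) *
       qvar (depth (G \<circ> Inl) (G (Inl i))))"
proof -
  let ?F = "attach n V J d G"
  have G_le: "G (Inr v) \<le> n" if "v \<in> V - J" for v using G that by (simp add: parent_funs_iff)
  have G_less: "G (Inl i) < i" if "1 \<le> i" "i \<le> n" for i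
    using G that by (simp add: parent_funs_iff)
  have "{w \<in> vertices (Suc n) V. ?F w = Suc n} = Inr ` J"
  proof (rule set_eqI)
    fix w
    show "w \<in> {w \<in> vertices (Suc n) V. ?F w = Suc n} \<longleftrightarrow> w \<in> Inr ` J"
    proof (cases w)
      case (Inl i)
      have "?F (Inl i) \<noteq> Suc n" if "1 \<le> i" "i \<le> Suc n"
        using G_less[of i] that d by (cases "i = Suc n") (auto simp: attach_Inl attach_last)
      with Inl show ?thesis by auto
    next
      case (Inr v)
      have "v \<in> V \<and> ?F (Inr v) = Suc n \<longleftrightarrow> v \<in> J"
        using G_le[of v] J by (auto simp: attach_Inr split: if_splits)
      with Inr show ?thesis by auto
    qed
  qed
  then have top: "card {w \<in> vertices (Suc n) V. ?F w = Suc n} = card J"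
    by (simp add: card_image)
  have rest: "card {w \<in> vertices (Suc n) V. ?F w = i} =
      card {w \<in> vertices n (V - J). G w = i} + (if d = i then 1 else 0)" if i: "i \<in> {1..n}" for i
  proof -
    have "{w \<in> vertices (Suc n) V. ?F w = i} =
        {w \<in> vertices n (V - J). G w = i} \<union> (if d = i then {Inl (Suc n)} else {})"
    proof (rule set_eqI)
      fix w
      show "w \<in> {w \<in> vertices (Suc n) V. ?F w = i} \<longleftrightarrow>
          w \<in> {w \<in> vertices n (V - J). G w = i} \<union> (if d = i then {Inl (Suc n)} else {})"
      proof (cases w)
        case (Inl j)
        then show ?thesis
          by (cases "j = Suc n") (auto simp: attach_Inl attach_last)
      next
        case (Inr v)
        then show ?thesis using i by (auto simp: attach_Inr)
      qed
    qed
    moreover have "finite {w \<in> vertices n (V - J). G w = i}"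
      using finite_vertices[of "V - J" n] fin by simp
    ultimately show ?thesis by simp
  qed
  have "(\<Prod>i\<in>{1..n}. qconst (\<phi> (card {w \<in> vertices (Suc n) V. ?F w = i})) *
      qvar (depth (?F \<circ> Inl) (?F (Inl i)))) =
    (\<Prod>i\<in>{1..n}. qconst (\<phi> (card {w \<in> vertices n (V - J). G w = i} + (if d = i then 1 else 0))) *
       qvar (depth (G \<circ> Inl) (G (Inl i))))"
  proof (rule prod.cong[OF refl], goal_cases)
    case (1 i)
    then have "G (Inl i) \<le> n" using G_less[of i] by simp
    with 1 show ?case by (simp only: rest) (simp add: attach_Inl depth_attach)
  qed
  moreover have "{1..Suc n} = insert (Suc n) {1..n}" by auto
  ultimately show ?thesis
    using d by (simp add: parent_weight_def top attach_last depth_attach)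
qed

text \<open>The conditions on heights and on the number of roots stay hidden in the membership of
  \<open>attach n V J d G\<close>, so that one bijection serves both new roots and inner
  attachments.\<close>

definition attach_data ::
    "nat \<Rightarrow> nat \<Rightarrow> 'v set \<Rightarrow> ('v \<Rightarrow> nat) \<Rightarrow> ('v set \<times> nat \<times> (nat + 'v \<Rightarrow> nat)) set" where
  "attach_data n k V \<kappa> = {(J, d, G). J \<subseteq> V \<and> d \<le> n \<and> G \<in> parent_funs n (V - J) \<and>
     attach n V J d G \<in> parent_maps (Suc n) k V \<kappa>}"

lemma bij_betw_attach:
  "bij_betw (\<lambda>(J, d, G). attach n V J d G) (attach_data n k V \<kappa>) (parent_maps (Suc n) k V \<kappa>)"
proof (rule bij_betw_byWitness[where
      f' = "\<lambda>F. ({v \<in> V. F (Inr v) = Suc n}, F (Inl (Suc n)),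
        restrict F (vertices n (V - {v \<in> V. F (Inr v) = Suc n})))"])
  show "\<forall>p\<in>attach_data n k V \<kappa>. (\<lambda>F. ({v \<in> V. F (Inr v) = Suc n}, F (Inl (Suc n)),
        restrict F (vertices n (V - {v \<in> V. F (Inr v) = Suc n}))))
      (case p of (J, d, G) \<Rightarrow> attach n V J d G) = p"
  proof (rule ballI)
    fix p assume "p \<in> attach_data n k V \<kappa>"
    then obtain J d G where p: "p = (J, d, G)" "J \<subseteq> V" "d \<le> n" "G \<in> parent_funs n (V - J)"
      by (auto simp: attach_data_def)
    \<comment> \<open>Leaves outside \<open>J\<close> keep a parent of label at most
      \<open>n\<close>, so \<open>J\<close> can be recovered as the set of leaves below
      \<open>Suc n\<close>.\<close>
    have "G (Inr v) \<le> n" if "v \<in> V - J" for v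
      using p(4) that unfolding parent_funs_iff by blast
    then have "\<And>v. v \<in> V - J \<Longrightarrow> G (Inr v) \<noteq> Suc n" by force
    then have J: "{v \<in> V. attach n V J d G (Inr v) = Suc n} = J"
      using p(2) by (auto simp: attach_Inr split: if_splits)
    have "restrict (attach n V J d G) (vertices n (V - J)) = G"
    proof (rule extensionalityI)
      show "G \<in> extensional (vertices n (V - J))" using p by (simp add: parent_funs_iff)
      fix w assume "w \<in> vertices n (V - J)"
      then show "restrict (attach n V J d G) (vertices n (V - J)) w = G w"
        by (cases w) (auto simp: attach_Inl attach_Inr)
    qed simp
    with J p(1) show "(\<lambda>F. ({v \<in> V. F (Inr v) = Suc n}, F (Inl (Suc n)),
        restrict F (vertices n (V - {v \<in> V. F (Inr v) = Suc n}))))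
      (case p of (J, d, G) \<Rightarrow> attach n V J d G) = p"
      by (simp add: attach_last)
  qed
  have inv: "attach n V J (F (Inl (Suc n))) (restrict F (vertices n (V - J))) = F"
    if F: "F \<in> parent_funs (Suc n) V" and J: "J = {v \<in> V. F (Inr v) = Suc n}" for F J
  proof (rule extensionalityI)
    show "attach n V J (F (Inl (Suc n))) (restrict F (vertices n (V - J)))
        \<in> extensional (vertices (Suc n) V)"
      by (simp add: attach_def)
    show "F \<in> extensional (vertices (Suc n) V)" using F by (simp add: parent_funs_iff)
    fix w assume "w \<in> vertices (Suc n) V"
    then show "attach n V J (F (Inl (Suc n))) (restrict F (vertices n (V - J))) w = F w"
      using J by (cases w) (auto simp: attach_def)
  qed
  show "\<forall>F\<in>parent_maps (Suc n) k V \<kappa>. (case ({v \<in> V. F (Inr v) = Suc n}, F (Inl (Suc n)),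
        restrict F (vertices n (V - {v \<in> V. F (Inr v) = Suc n})))
      of (J, d, G) \<Rightarrow> attach n V J d G) = F"
    using inv by (simp add: parent_maps_def)
  show "(\<lambda>(J, d, G). attach n V J d G) ` attach_data n k V \<kappa> \<subseteq> parent_maps (Suc n) k V \<kappa>"
    by (auto simp: attach_data_def)
  show "(\<lambda>F. ({v \<in> V. F (Inr v) = Suc n}, F (Inl (Suc n)),
        restrict F (vertices n (V - {v \<in> V. F (Inr v) = Suc n})))) ` parent_maps (Suc n) k V \<kappa>
      \<subseteq> attach_data n k V \<kappa>"
  proof (rule image_subsetI)
    fix F assume F: "F \<in> parent_maps (Suc n) k V \<kappa>"
    then have F': "F \<in> parent_funs (Suc n) V" by (simp add: parent_maps_def)
    define J where "J = {v \<in> V. F (Inr v) = Suc n}"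
    have "F (Inl (Suc n)) < Suc n" using F' unfolding parent_funs_iff by simp
    then have "F (Inl (Suc n)) \<le> n" by simp
    moreover have "restrict F (vertices n (V - J)) \<in> parent_funs n (V - J)"
      using F' unfolding parent_funs_iff by (auto simp: J_def le_Suc_eq)
    ultimately show "({v \<in> V. F (Inr v) = Suc n}, F (Inl (Suc n)),
        restrict F (vertices n (V - {v \<in> V. F (Inr v) = Suc n}))) \<in> attach_data n k V \<kappa>"
      using F inv[OF F' J_def] unfolding J_def[symmetric] attach_data_def by (simp add: J_def)
  qed
qed

lemma finite_attach_data:
  assumes "finite V"
  shows "finite (attach_data n k V \<kappa>)"
  using bij_betw_finite[OF bij_betw_attach] finite_parent_maps[OF assms] by blast

section \<open>The contributions of root and non-root attachments\<close>

lemma attach_root_sum: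
  assumes fin: "finite V" and k: "1 \<le> k"
  shows "(\<Sum>(J, d, G)\<in>{p \<in> attach_data n k V \<kappa>. fst (snd p) = 0}.
      parent_weight \<phi> (Suc n) V (attach n V J d G)) =
    qvar 0 * (\<Sum>J\<in>Pow {v \<in> V. \<kappa> v = 1}. qconst (\<phi> (card J)) * forest_sum \<phi> n (k - 1) (V - J) \<kappa>)"
proof -
  let ?A = "SIGMA J:Pow {v \<in> V. \<kappa> v = 1}. parent_maps n (k - 1) (V - J) \<kappa>"
  let ?f = "\<lambda>(J, G). qvar 0 * (qconst (\<phi> (card J)) * parent_weight \<phi> n (V - J) G)"
  have "(\<Sum>(J, d, G)\<in>{p \<in> attach_data n k V \<kappa>. fst (snd p) = 0}.
      parent_weight \<phi> (Suc n) V (attach n V J d G)) = sum ?f ?A"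
  proof (rule sum.reindex_bij_witness[of _ "\<lambda>(J, G). (J, 0, G)" "\<lambda>(J, d, G). (J, G)"], goal_cases)
    case (2 p)
    then obtain J G where p: "p = (J, 0, G)" "J \<subseteq> V" "G \<in> parent_funs n (V - J)"
      "attach n V J 0 G \<in> parent_maps (Suc n) k V \<kappa>"
      by (auto simp: attach_data_def)
    then show ?case
      unfolding attach_in_parent_maps_iff[OF p(2) le0 p(3)] by (auto simp: parent_maps_def)
  next
    case (4 p)
    then obtain J G where p: "p = (J, G)" "J \<subseteq> {v \<in> V. \<kappa> v = 1}" "G \<in> parent_maps n (k - 1) (V - J) \<kappa>"
      by auto
    then have J: "J \<subseteq> V" and G: "G \<in> parent_funs n (V - J)" by (auto simp: parent_maps_def)
    \<comment> \<open>The new root brings the count from \<open>k - 1\<close> to \<open>k\<close>;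
      the bound \<open>1 \<le> k\<close> makes this subtraction exact.\<close>
    have "attach n V J 0 G \<in> parent_maps (Suc n) k V \<kappa>"
      unfolding attach_in_parent_maps_iff[OF J le0 G]
      using p(2,3) k by (auto simp: parent_maps_def)
    with p(1) J G show ?case by (simp add: attach_data_def)
  next
    case (5 p)
    then obtain J G where p: "p = (J, 0, G)" "J \<subseteq> V" "G \<in> parent_funs n (V - J)"
      by (auto simp: attach_data_def)
    have "(\<Prod>i\<in>{1..n}. qconst (\<phi> (card {w \<in> vertices n (V - J). G w = i} + (if 0 = i then 1 else 0))) *
       qvar (depth (G \<circ> Inl) (G (Inl i)))) = parent_weight \<phi> n (V - J) G"
      unfolding parent_weight_def by (rule prod.cong) auto
    with p show ?case
      by (simp add: parent_weight_attach[OF p(2) le0 p(3) fin] mult_ac)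
  qed auto
  also have "\<dots> = (\<Sum>J\<in>Pow {v \<in> V. \<kappa> v = 1}. \<Sum>G\<in>parent_maps n (k - 1) (V - J) \<kappa>. ?f (J, G))"
    using fin by (subst sum.Sigma) (auto intro!: finite_parent_maps)
  finally show ?thesis
    by (simp add: forest_sum_parent_maps sum_distrib_left)
qed

text \<open>A new leaf \<open>None\<close>, attached to the vertex \<open>d\<close>, takes the place of the vertex \<open>Suc n\<close>.\<close>

definition add_leaf :: "nat \<Rightarrow> 'v set \<Rightarrow> nat \<Rightarrow> (nat + 'v \<Rightarrow> nat) \<Rightarrow> nat + 'v option \<Rightarrow> nat" where
  "add_leaf n U d G =
     restrict (case_sum (G \<circ> Inl) (case_option d (G \<circ> Inr))) (vertices n (insert None (Some ` U)))"

lemma add_leaf_simps: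
  "1 \<le> i \<Longrightarrow> i \<le> n \<Longrightarrow> add_leaf n U d G (Inl i) = G (Inl i)"
  "add_leaf n U d G (Inr None) = d"
  "v \<in> U \<Longrightarrow> add_leaf n U d G (Inr (Some v)) = G (Inr v)"
  by (auto simp: add_leaf_def)

lemma depth_add_leaf: "i \<le> n \<Longrightarrow> depth (add_leaf n U d G \<circ> Inl) i = depth (G \<circ> Inl) i"
  by (rule depth_cong) (simp add: add_leaf_simps)

lemma add_leaf_in_parent_funs_iff:
  assumes "G \<in> extensional (vertices n U)"
  shows "add_leaf n U d G \<in> parent_funs n (insert None (Some ` U)) \<longleftrightarrow>
    1 \<le> d \<and> d \<le> n \<and> G \<in> parent_funs n U"
  using assms by (auto simp: parent_funs_iff add_leaf_simps) (auto simp: add_leaf_def)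

text \<open>Requiring height \<open>i\<close> of the leaf \<open>None\<close> fixes the depth of its
  parent \<open>d\<close>, which is the height that \<open>Suc n\<close> has when attached to
  \<open>d\<close>.\<close>

lemma add_leaf_in_parent_maps_iff:
  assumes "G \<in> parent_funs n U" "1 \<le> d" "d \<le> n"
  shows "add_leaf n U d G \<in> parent_maps n k (insert None (Some ` U)) (case_option i \<kappa>) \<longleftrightarrow>
    G \<in> parent_maps n k U \<kappa> \<and> depth (G \<circ> Inl) d = i"
proof -
  have "{i \<in> {1..n}. add_leaf n U d G (Inl i) = 0} = {i \<in> {1..n}. G (Inl i) = 0}"
    by (auto simp: add_leaf_simps)
  moreover have "depth (add_leaf n U d G \<circ> Inl) (G (Inr v)) = depth (G \<circ> Inl) (G (Inr v))"
    if "v \<in> U" for v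
    using assms that by (intro depth_add_leaf) (simp add: parent_funs_iff)
  moreover have "add_leaf n U d G \<in> parent_funs n (insert None (Some ` U))"
    using assms by (subst add_leaf_in_parent_funs_iff) (auto simp: parent_funs_iff)
  ultimately show ?thesis
    using assms by (auto simp: parent_maps_def add_leaf_simps depth_add_leaf)
qed

lemma bij_betw_add_leaf:
  "bij_betw (\<lambda>(d, G). add_leaf n U d G) ({1..n} \<times> parent_funs n U)
     (parent_funs n (insert None (Some ` U)))"
proof (rule bij_betw_byWitness[where
      f' = "\<lambda>H. (H (Inr None), restrict (\<lambda>w. H (map_sum id Some w)) (vertices n U))"])
  have *: "restrict (\<lambda>w. add_leaf n U d G (map_sum id Some w)) (vertices n U) = G"
    if "G \<in> parent_funs n U" for d G
  proof (rule extensionalityI)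
    show "G \<in> extensional (vertices n U)" using that by (simp add: parent_funs_iff)
    fix w assume "w \<in> vertices n U"
    then show "restrict (\<lambda>w. add_leaf n U d G (map_sum id Some w)) (vertices n U) w = G w"
      by (cases w) (auto simp: add_leaf_simps)
  qed simp
  then show "\<forall>p\<in>{1..n} \<times> parent_funs n U.
      (\<lambda>H. (H (Inr None), restrict (\<lambda>w. H (map_sum id Some w)) (vertices n U)))
        (case p of (d, G) \<Rightarrow> add_leaf n U d G) = p"
    by (auto simp: add_leaf_simps)
  have inv: "add_leaf n U (H (Inr None)) (restrict (\<lambda>w. H (map_sum id Some w)) (vertices n U)) = H"
    if "H \<in> parent_funs n (insert None (Some ` U))" for H
  proof (rule extensionalityI)
    show "H \<in> extensional (vertices n (insert None (Some ` U)))"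
      using that by (simp add: parent_funs_iff)
    fix w :: "nat + 'a option" assume "w \<in> vertices n (insert None (Some ` U))"
    then show "add_leaf n U (H (Inr None)) (restrict (\<lambda>w. H (map_sum id Some w)) (vertices n U)) w = H w"
      by (cases w) (auto simp: add_leaf_simps)
  qed (simp add: add_leaf_def)
  then show "\<forall>H\<in>parent_funs n (insert None (Some ` U)).
      (case (H (Inr None), restrict (\<lambda>w. H (map_sum id Some w)) (vertices n U))
        of (d, G) \<Rightarrow> add_leaf n U d G) = H"
    by simp
  show "(\<lambda>(d, G). add_leaf n U d G) ` ({1..n} \<times> parent_funs n U)
      \<subseteq> parent_funs n (insert None (Some ` U))"
  proof (rule image_subsetI)
    fix p assume "p \<in> {1..n} \<times> parent_funs n U"
    then obtain d G where p: "p = (d, G)" "1 \<le> d" "d \<le> n" "G \<in> parent_funs n U" by auto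
    then have "G \<in> extensional (vertices n U)" by (simp add: parent_funs_iff)
    with p show "(case p of (d, G) \<Rightarrow> add_leaf n U d G) \<in> parent_funs n (insert None (Some ` U))"
      by (simp add: add_leaf_in_parent_funs_iff)
  qed
  show "(\<lambda>H. (H (Inr None), restrict (\<lambda>w. H (map_sum id Some w)) (vertices n U))) `
      parent_funs n (insert None (Some ` U)) \<subseteq> {1..n} \<times> parent_funs n U"
    by (rule image_subsetI) (auto simp: parent_funs_iff)
qed

text \<open>The leaf \<open>None\<close> counts as a child of \<open>d\<close> just as
  \<open>Suc n\<close> does, so for \<open>U = V - J\<close> this is exactly the product left over
  in \<open>parent_weight_attach\<close>.\<close>

lemma parent_weight_add_leaf:
  assumes G: "G \<in> parent_funs n U" and fin: "finite U"
  shows "parent_weight \<phi> n (insert None (Some ` U)) (add_leaf n U d G) =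
    (\<Prod>i\<in>{1..n}. qconst (\<phi> (card {w \<in> vertices n U. G w = i} + (if d = i then 1 else 0))) *
       qvar (depth (G \<circ> Inl) (G (Inl i))))"
  unfolding parent_weight_def
proof (rule prod.cong[OF refl], goal_cases)
  case (1 i)
  let ?H = "add_leaf n U d G" and ?U = "insert None (Some ` U)"
  have "{w \<in> vertices n ?U. ?H w = i} =
      map_sum id Some ` {w \<in> vertices n U. G w = i} \<union> (if d = i then {Inr None} else {})"
  proof (rule set_eqI)
    fix w :: "nat + 'a option"
    have inj: "inj (map_sum id Some :: nat + 'a \<Rightarrow> nat + 'a option)"
      by (intro injI) (auto simp: map_sum_def split: sum.splits)
    show "w \<in> {w \<in> vertices n ?U. ?H w = i} \<longleftrightarrow>
        w \<in> map_sum id Some ` {w \<in> vertices n U. G w = i} \<union> (if d = i then {Inr None} else {})"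
    proof (cases "w = Inr None")
      case True
      then show ?thesis by (auto simp: add_leaf_simps map_sum_def split: sum.splits)
    next
      case False
      then obtain u where u: "w = map_sum id Some u"
        by (cases w; cases "projr w") (metis id_apply map_sum.simps sum.sel(2))+
      have "u \<in> vertices n U \<longleftrightarrow> w \<in> vertices n ?U" using u by (cases u) auto
      moreover have "?H w = G u" if "u \<in> vertices n U"
        using u that by (cases u) (auto simp: add_leaf_simps)
      ultimately show ?thesis using False u by (auto simp: inj_image_mem_iff[OF inj])
    qed
  qed
  moreover have "Inr None \<notin> map_sum id Some ` {w \<in> vertices n U. G w = i}"
    by (auto simp: map_sum_def split: sum.splits)
  moreover have "card (map_sum id Some ` {w \<in> vertices n U. G w = i}) = card {w \<in> vertices n U. G w = i}"
    by (rule card_image, rule inj_onI) (auto simp: map_sum_def split: sum.splits)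
  moreover have "finite {w \<in> vertices n U. G w = i}" using finite_vertices[OF fin, of n] by simp
  ultimately have "card {w \<in> vertices n ?U. ?H w = i} =
      card {w \<in> vertices n U. G w = i} + (if d = i then 1 else 0)"
    by simp
  moreover have "G (Inl i) < i" using G 1 by (simp add: parent_funs_iff)
  ultimately show ?case using 1 by (simp add: add_leaf_simps depth_add_leaf)
qed

text \<open>The parent \<open>d\<close> is absorbed into the smaller forest as the parent of
  \<open>None\<close>. What remains visible is the height \<open>i\<close> of the new vertex, by
  which the sum is organised; its children then have height \<open>Suc i\<close>.\<close>

lemma attach_nonroot_sum:
  assumes fin: "finite V"
  shows "(\<Sum>(J, d, G)\<in>{p \<in> attach_data n k V \<kappa>. fst (snd p) \<noteq> 0}.
      parent_weight \<phi> (Suc n) V (attach n V J d G)) =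
    (\<Sum>i=1..n. qvar i * (\<Sum>J\<in>Pow {v \<in> V. \<kappa> v = Suc i}.
       qconst (\<phi> (card J)) * forest_sum \<phi> n k (insert None (Some ` (V - J))) (case_option i \<kappa>)))"
proof -
  let ?U = "\<lambda>J. insert None (Some ` (V - J))"
  let ?A = "SIGMA i:{1..n}. SIGMA J:Pow {v \<in> V. \<kappa> v = Suc i}. parent_maps n k (?U J) (case_option i \<kappa>)"
  let ?f = "\<lambda>(i, J, H). qvar i * (qconst (\<phi> (card J)) * parent_weight \<phi> n (?U J) H)"
  let ?h = "\<lambda>(J, d, G). (depth (G \<circ> Inl) d, J, add_leaf n (V - J) d G)"
  let ?X = "{p \<in> attach_data n k V \<kappa>. fst (snd p) \<noteq> 0}"
  have X: "(J, d, G) \<in> ?X \<longleftrightarrow> J \<subseteq> V \<and> 1 \<le> d \<and> d \<le> n \<and> G \<in> parent_funs n (V - J) \<and>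
      (depth (G \<circ> Inl) d, J, add_leaf n (V - J) d G) \<in> ?A" for J d G
  proof (cases "J \<subseteq> V \<and> 1 \<le> d \<and> d \<le> n \<and> G \<in> parent_funs n (V - J)")
    case True
    then have J: "J \<subseteq> V" and d: "1 \<le> d" "d \<le> n" and G: "G \<in> parent_funs n (V - J)" by auto
    \<comment> \<open>A parent \<open>d\<close> other than 0 has depth at least 1, and
      \<open>depth_le\<close> bounds it by \<open>n\<close>; this gives the range of
      \<open>i\<close>.\<close>
    have "G (Inl d) < d" using G d by (simp add: parent_funs_iff)
    then have "depth (G \<circ> Inl) d \<in> {1..n}"
      using d depth_le[of "G \<circ> Inl" d] by (simp add: depth_less)
    with True show ?thesis
      using attach_in_parent_maps_iff[OF J d(2) G, of k \<kappa>]
        add_leaf_in_parent_maps_iff[OF G d, of k "depth (G \<circ> Inl) d" \<kappa>]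
      by (auto simp: attach_data_def parent_maps_def)
  next
    case False
    then show ?thesis by (auto simp: attach_data_def)
  qed
  have bij: "bij_betw ?h ?X ?A"
  proof (rule bij_betw_imageI)
    show "inj_on ?h ?X"
    proof (rule inj_onI)
      fix p p' assume pX: "p \<in> ?X" "p' \<in> ?X" and eq: "?h p = ?h p'"
      obtain J d G J' d' G' where p: "p = (J, d, G)" "p' = (J', d', G')"
        by (cases p, cases p') auto
      have J: "J' = J" and leaf: "add_leaf n (V - J) d G = add_leaf n (V - J) d' G'"
        using eq p by auto
      have "(d, G) \<in> {1..n} \<times> parent_funs n (V - J)" "(d', G') \<in> {1..n} \<times> parent_funs n (V - J)"
        using pX unfolding p X J by auto
      with leaf have "(d, G) = (d', G')"
        by (intro inj_onD[OF bij_betw_imp_inj_on[OF bij_betw_add_leaf[of n "V - J"]]]) simp_all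
      with p J show "p = p'" by simp
    qed
    show "?h ` ?X = ?A"
    proof
      show "?h ` ?X \<subseteq> ?A"
      proof (rule image_subsetI)
        fix p assume "p \<in> ?X"
        then show "?h p \<in> ?A" by (cases p) (simp only: X prod.case)
      qed
      show "?A \<subseteq> ?h ` ?X"
      proof
        fix q assume q: "q \<in> ?A"
        then obtain i J H where qe: "q = (i, J, H)" and J: "J \<subseteq> V"
          and H: "H \<in> parent_maps n k (?U J) (case_option i \<kappa>)" by auto
        have "H \<in> (\<lambda>(d, G). add_leaf n (V - J) d G) ` ({1..n} \<times> parent_funs n (V - J))"
          unfolding bij_betw_imp_surj_on[OF bij_betw_add_leaf] using H by (simp add: parent_maps_def)
        then obtain d G where dG: "d \<in> {1..n}" "G \<in> parent_funs n (V - J)" "H = add_leaf n (V - J) d G"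
          by auto
        then have i: "depth (G \<circ> Inl) d = i"
          using H add_leaf_in_parent_maps_iff[OF dG(2), of d k i \<kappa>] by simp
        with q qe J dG have "(J, d, G) \<in> ?X" unfolding X by simp
        moreover have "?h (J, d, G) = q" using qe dG i by simp
        ultimately show "q \<in> ?h ` ?X" by (metis (no_types, lifting) image_eqI)
      qed
    qed
  qed
  have "(\<Sum>(J, d, G)\<in>?X. parent_weight \<phi> (Suc n) V (attach n V J d G)) = (\<Sum>p\<in>?X. ?f (?h p))"
  proof (rule sum.cong[OF refl])
    fix p assume "p \<in> ?X"
    moreover obtain J d G where p: "p = (J, d, G)" by (cases p)
    ultimately have "J \<subseteq> V" "d \<le> n" "G \<in> parent_funs n (V - J)" unfolding p X by auto
    with p fin show "(case p of (J, d, G) \<Rightarrow> parent_weight \<phi> (Suc n) V (attach n V J d G)) = ?f (?h p)"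
      by (simp add: parent_weight_attach parent_weight_add_leaf mult_ac)
  qed
  also have "\<dots> = sum ?f ?A" by (rule sum.reindex_bij_betw[OF bij])
  also have "\<dots> = (\<Sum>i=1..n. \<Sum>J\<in>Pow {v \<in> V. \<kappa> v = Suc i}.
      \<Sum>H\<in>parent_maps n k (?U J) (case_option i \<kappa>). ?f (i, J, H))"
    using fin by (simp add: sum.Sigma finite_parent_maps case_prod_unfold)
  finally show ?thesis
    by (simp add: forest_sum_parent_maps sum_distrib_left)
qed

text \<open>The recurrence for leaf sets, before any factorials enter. Each sum over
  \<open>J\<close> will become a product with \<phi>, and the extra leaf \<open>None\<close> a
  derivative.\<close>

lemma forest_sum_Suc:
  assumes fin: "finite V" and k: "1 \<le> k"
  shows "forest_sum \<phi> (Suc n) k V \<kappa> =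
    qvar 0 * (\<Sum>J\<in>Pow {v \<in> V. \<kappa> v = 1}. qconst (\<phi> (card J)) * forest_sum \<phi> n (k - 1) (V - J) \<kappa>) +
    (\<Sum>i=1..n. qvar i * (\<Sum>J\<in>Pow {v \<in> V. \<kappa> v = Suc i}.
       qconst (\<phi> (card J)) * forest_sum \<phi> n k (insert None (Some ` (V - J))) (case_option i \<kappa>)))"
proof -
  let ?w = "\<lambda>(J, d, G). parent_weight \<phi> (Suc n) V (attach n V J d G)"
  let ?X = "attach_data n k V \<kappa>"
  have "forest_sum \<phi> (Suc n) k V \<kappa> = sum ?w ?X"
    unfolding forest_sum_parent_maps
    by (subst sum.reindex_bij_betw[OF bij_betw_attach, symmetric]) (simp add: case_prod_unfold)
  also have "\<dots> = sum ?w {p \<in> ?X. fst (snd p) = 0} + sum ?w {p \<in> ?X. fst (snd p) \<noteq> 0}"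
    by (subst sum.union_disjoint[symmetric])
       (auto simp: finite_attach_data[OF fin] intro!: sum.cong)
  finally show ?thesis
    by (simp only: attach_root_sum[OF fin k] attach_nonroot_sum[OF fin])
qed


section \<open>Comparing coefficients\<close>

text \<open>No support condition on \<open>e\<close> remains: outside \<open>{1..n}\<close> both
  sides vanish. The recurrence needs this, as its exponents may involve variables that the smaller
  series does not contain.\<close>

lemma Bser_coeff_forest_sum:
  fixes V :: "'v set"
  assumes \<iota>: "rat_embedding \<iota>" and fin: "finite V"
    and card: "\<And>i. card {v \<in> V. \<kappa> v = i} = Poly_Mapping.lookup e i"
  shows "qconst (\<iota> (exp_fact e)) * mps_coeff (Bser \<iota> \<phi> n k) e = forest_sum \<phi> n k V \<kappa>"
proof (cases "Poly_Mapping.keys e \<subseteq> {1..n}")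
  case True
  have "\<kappa> v \<in> Poly_Mapping.keys e" if "v \<in> V" for v
  proof -
    have "card {u \<in> V. \<kappa> u = \<kappa> v} \<noteq> 0" using that fin by auto
    then show ?thesis by (simp add: card in_keys_iff)
  qed
  with True have "\<kappa> ` V \<subseteq> {1..n}" by blast
  then show ?thesis using \<iota> True fin card by (intro Bser_coeff)
next
  case False
  then obtain i where i: "i \<in> Poly_Mapping.keys e" "i \<notin> {1..n}" by blast
  then have "card {v \<in> V. \<kappa> v = i} \<noteq> 0" by (simp add: card in_keys_iff)
  then have "{v \<in> V. \<kappa> v = i} \<noteq> {}" by force
  then obtain v where "v \<in> V" "\<kappa> v \<notin> {1..n}" using i by auto
  then have "forest_sum \<phi> n k V \<kappa> = 0" by (rule forest_sum_height_range)
  with False show ?thesis by (simp add: Bser_def)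
qed

text \<open>The set \<open>A\<close> stands for the leaves of height \<open>i\<close>. Choosing
  \<open>j\<close> of them as children gives a binomial coefficient, which is what the denominator
  \<open>fact j\<close> in \<phi> yields together with the factorials of the exponents.\<close>

lemma phi_at_mult_coeff:
  assumes \<iota>: "rat_embedding \<iota>" and fin: "finite A" and card: "card A = Poly_Mapping.lookup e i"
  shows "qconst (\<iota> (exp_fact e)) * mps_coeff (phi_at \<iota> \<phi> i * mps_const c * G) e =
    c * (\<Sum>J\<in>Pow A. qconst (\<phi> (card J)) *
      (qconst (\<iota> (exp_fact (e - Poly_Mapping.single i (card J)))) *
        mps_coeff G (e - Poly_Mapping.single i (card J))))"
proof -
  let ?m = "Poly_Mapping.lookup e i" and ?a = "\<lambda>j. e - Poly_Mapping.single i j"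
  let ?q = "\<lambda>r. qconst (\<iota> r)"
  \<comment> \<open>With \<open>m\<close> the exponent of the variable, m!/j! is the binomial
    coefficient times (m - j)!; the other factorials in \<open>exp_fact e\<close> are
    unaffected.\<close>
  have fact: "?q (exp_fact e) * ?q (1 / fact j) = of_nat (?m choose j) * ?q (exp_fact (?a j))"
    if j: "j \<le> ?m" for j
  proof -
    have e: "?a j + Poly_Mapping.single i j = e"
      using j by (intro poly_mapping_eqI) (auto simp: lookup_add lookup_minus lookup_single when_def)
    have "Poly_Mapping.lookup (?a j) i = ?m - j" by (simp add: lookup_minus)
    then have "exp_fact e * fact (?m - j) = exp_fact (?a j) * fact ?m"
      using exp_fact_add_single[of "?a j" i j] j by (simp add: e)
    then have "exp_fact e * (1 / fact j) = of_nat (?m choose j) * exp_fact (?a j)"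
      using j by (simp add: binomial_fact field_simps)
    then show ?thesis
      by (metis qconst_rat_hom(1,3)[OF \<iota>])
  qed
  have "phi_at \<iota> \<phi> i * mps_const c * G = mps_const c * (phi_at \<iota> \<phi> i * G)"
    by (simp add: mult_ac)
  then have "mps_coeff (phi_at \<iota> \<phi> i * mps_const c * G) e = c * mps_coeff (phi_at \<iota> \<phi> i * G) e"
    by (simp only: mps_coeff_const_mult)
  moreover have "mps_coeff (phi_at \<iota> \<phi> i * G) e =
      (\<Sum>j\<le>?m. ?q (1 / fact j) * qconst (\<phi> j) * mps_coeff G (?a j))"
    by (simp add: phi_at_def mps_coeff_mps_of_fps_mult phi_series_def qconst_mult)
  ultimately have "?q (exp_fact e) * mps_coeff (phi_at \<iota> \<phi> i * mps_const c * G) e =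
      c * (\<Sum>j\<le>?m. (?q (exp_fact e) * ?q (1 / fact j)) * (qconst (\<phi> j) * mps_coeff G (?a j)))"
    by (simp only:) (simp add: sum_distrib_left mult_ac)
  also have "(\<Sum>j\<le>?m. (?q (exp_fact e) * ?q (1 / fact j)) * (qconst (\<phi> j) * mps_coeff G (?a j))) =
      (\<Sum>j\<le>card A. of_nat (card A choose j) *
        (qconst (\<phi> j) * (?q (exp_fact (?a j)) * mps_coeff G (?a j))))"
    unfolding card by (rule sum.cong[OF refl]) (simp add: fact mult_ac)
  also have "\<dots> = (\<Sum>J\<in>Pow A. qconst (\<phi> (card J)) *
      (?q (exp_fact (?a (card J))) * mps_coeff G (?a (card J))))"
    by (rule sum_Pow_card[OF fin, symmetric])
  finally show ?thesis .
qed

text \<open>For exponential coefficients a derivative is a pure shift: one more leaf of height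
  \<open>i\<close>.\<close>

lemma mps_deriv_coeff_exp_fact:
  assumes \<iota>: "rat_embedding \<iota>"
  shows "qconst (\<iota> (exp_fact a)) * mps_coeff (mps_deriv i G) a =
    qconst (\<iota> (exp_fact (a + Poly_Mapping.single i 1))) *
      mps_coeff G (a + Poly_Mapping.single i 1)"
proof -
  let ?m = "Poly_Mapping.lookup a i"
  have "exp_fact (a + Poly_Mapping.single i 1) = exp_fact a * of_nat (?m + 1)"
    using exp_fact_add_single[of a i 1] by simp
  then show ?thesis
    by (simp only: qconst_rat_hom(1,3)[OF \<iota>]) (simp add: mps_deriv_def mult_ac)
qed

lemma Bser_Suc:
  assumes \<iota>: "rat_embedding \<iota>" and k: "1 \<le> k"
  shows "Bser \<iota> \<phi> (Suc n) k =
    phi_at \<iota> \<phi> 1 * mps_const (qvar 0) * Bser \<iota> \<phi> n (k - 1) +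
    (\<Sum>i=1..n. phi_at \<iota> \<phi> (Suc i) * mps_const (qvar i) * mps_deriv i (Bser \<iota> \<phi> n k))"
proof (rule mps_eqI, rule exp_fact_cancel[OF \<iota>])
  fix e :: "nat \<Rightarrow>\<^sub>0 nat"
  let ?q = "\<lambda>a. qconst (\<iota> (exp_fact a))"
  \<comment> \<open>Indexing by the whole support of \<open>e\<close>, rather than by a range of
    labels, gives the right fibre size over every \<open>i\<close>.\<close>
  define V where "V = (SIGMA i:Poly_Mapping.keys e. {..<Poly_Mapping.lookup e i})"
  have fin: "finite V" by (simp add: V_def)
  have card: "card {v \<in> V. fst v = i} = Poly_Mapping.lookup e i" for i
  proof -
    have "{v \<in> V. fst v = i} = Pair i ` {..<Poly_Mapping.lookup e i}"
      by (auto simp: V_def in_keys_iff)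
    then show ?thesis by (simp add: card_image inj_on_def)
  qed
  have card_rest: "card {v \<in> V - J. fst v = l} =
      Poly_Mapping.lookup (e - Poly_Mapping.single i (card J)) l"
    if J: "J \<subseteq> {v \<in> V. fst v = i}" for i J l
  proof -
    have finJ: "finite J" using J fin by (auto intro: finite_subset)
    have "{v \<in> V - J. fst v = l} = {v \<in> V. fst v = l} - (if l = i then J else {})"
      using J by auto
    moreover have "card ({v \<in> V. fst v = i} - J) = card {v \<in> V. fst v = i} - card J"
      using J finJ by (rule card_Diff_subset[rotated])
    ultimately show ?thesis
      by (cases "l = i") (simp_all add: card lookup_minus lookup_single when_def)
  qed
  have root: "?q e * mps_coeff (phi_at \<iota> \<phi> 1 * mps_const (qvar 0) * Bser \<iota> \<phi> n (k - 1)) e =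
      qvar 0 * (\<Sum>J\<in>Pow {v \<in> V. fst v = 1}.
        qconst (\<phi> (card J)) * forest_sum \<phi> n (k - 1) (V - J) fst)"
  proof (subst phi_at_mult_coeff[OF \<iota> _ card], goal_cases)
    case 2
    have "?q (e - Poly_Mapping.single 1 (card J)) *
        mps_coeff (Bser \<iota> \<phi> n (k - 1)) (e - Poly_Mapping.single 1 (card J)) =
        forest_sum \<phi> n (k - 1) (V - J) fst" if "J \<subseteq> {v \<in> V. fst v = 1}" for J
      using fin card_rest[OF that] by (intro Bser_coeff_forest_sum[OF \<iota>]) auto
    then show ?case by simp
  qed (simp add: fin)
  have nonroot: "?q e * mps_coeff (phi_at \<iota> \<phi> (Suc i) * mps_const (qvar i) * mps_deriv i (Bser \<iota> \<phi> n k)) e =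
      qvar i * (\<Sum>J\<in>Pow {v \<in> V. fst v = Suc i}. qconst (\<phi> (card J)) *
        forest_sum \<phi> n k (insert None (Some ` (V - J))) (case_option i fst))" for i
  proof (subst phi_at_mult_coeff[OF \<iota> _ card], goal_cases)
    case 2
    have "?q (e - Poly_Mapping.single (Suc i) (card J)) *
        mps_coeff (mps_deriv i (Bser \<iota> \<phi> n k)) (e - Poly_Mapping.single (Suc i) (card J)) =
        forest_sum \<phi> n k (insert None (Some ` (V - J))) (case_option i fst)"
      if J: "J \<subseteq> {v \<in> V. fst v = Suc i}" for J
      unfolding mps_deriv_coeff_exp_fact[OF \<iota>]
    proof (rule Bser_coeff_forest_sum[OF \<iota>])
      fix l
      \<comment> \<open>Taking \<open>J\<close> away lowers the exponent at \<open>Suc i\<close>,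
        and \<open>None\<close> raises the one at \<open>i\<close>.\<close>
      have "{v \<in> insert None (Some ` (V - J)). case_option i fst v = l} =
          Some ` {v \<in> V - J. fst v = l} \<union> (if l = i then {None} else {})"
        by auto
      then show "card {v \<in> insert None (Some ` (V - J)). case_option i fst v = l} =
          Poly_Mapping.lookup (e - Poly_Mapping.single (Suc i) (card J) + Poly_Mapping.single i 1) l"
        using fin card_rest[OF J, of l]
        by (auto simp: card_image lookup_add lookup_single when_def)
    qed (use fin in simp)
    then show ?case by simp
  qed (simp add: fin)
  show "?q e * mps_coeff (Bser \<iota> \<phi> (Suc n) k) e =
      ?q e * mps_coeff (phi_at \<iota> \<phi> 1 * mps_const (qvar 0) * Bser \<iota> \<phi> n (k - 1) +
        (\<Sum>i=1..n. phi_at \<iota> \<phi> (Suc i) * mps_const (qvar i) * mps_deriv i (Bser \<iota> \<phi> n k))) e"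
    by (simp only: Bser_coeff_forest_sum[OF \<iota> fin card] forest_sum_Suc[OF fin k]
          plus_mps.rep_eq mps_coeff_sum distrib_left sum_distrib_left root nonroot)
qed

section \<open>Initial value and vanishing cases\<close>

lemma Bser_0_0: "rat_embedding \<iota> \<Longrightarrow> Bser \<iota> \<phi> 0 0 = 1"
proof (rule mps_eqI)
  fix e :: "nat \<Rightarrow>\<^sub>0 nat" assume "rat_embedding \<iota>"
  then show "mps_coeff (Bser \<iota> \<phi> 0 0) e = mps_coeff 1 e"
    by (auto simp: Bser_def one_mps.rep_eq leaf_set_def forest_sum_empty exp_fact_def qconst_rat_hom(2))
qed

lemma Bser_no_roots: "1 \<le> n \<Longrightarrow> Bser \<iota> \<phi> n 0 = 0"
  by (rule mps_eqI) (simp add: Bser_def zero_mps.rep_eq forest_sum_no_roots)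

lemma Bser_many_roots: "n < k \<Longrightarrow> Bser \<iota> \<phi> n k = 0"
  by (rule mps_eqI) (simp add: Bser_def zero_mps.rep_eq forest_sum_many_roots)

theorem mainTheorem10:
  fixes \<iota> :: "rat \<Rightarrow> 'a::comm_ring_1" and \<phi> :: "nat \<Rightarrow> 'a"
  assumes "rat_embedding \<iota>"
  shows "Bser \<iota> \<phi> 1 1 = phi_at \<iota> \<phi> 1 * mps_const (qvar 0)
    \<and> (\<forall>n k. 2 \<le> n \<longrightarrow> 1 \<le> k \<longrightarrow> k \<le> n \<longrightarrow>
          Bser \<iota> \<phi> n k =
            phi_at \<iota> \<phi> 1 * mps_const (qvar 0) * Bser \<iota> \<phi> (n - 1) (k - 1)
            + (\<Sum>i = 1..n - 1.
                 phi_at \<iota> \<phi> (i + 1) * mps_const (qvar i) * mps_deriv i (Bser \<iota> \<phi> (n - 1) k)))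
    \<and> (\<forall>m\<ge>1. Bser \<iota> \<phi> m 0 = 0)
    \<and> (\<forall>m k. m < k \<longrightarrow> Bser \<iota> \<phi> m k = 0)"
proof (intro conjI allI impI)
  show "Bser \<iota> \<phi> 1 1 = phi_at \<iota> \<phi> 1 * mps_const (qvar 0)"
    using Bser_Suc[OF assms, of 1 \<phi> 0] by (simp add: Bser_0_0[OF assms])
next
  fix n k :: nat assume "2 \<le> n" "1 \<le> k"
  then show "Bser \<iota> \<phi> n k =
      phi_at \<iota> \<phi> 1 * mps_const (qvar 0) * Bser \<iota> \<phi> (n - 1) (k - 1)
      + (\<Sum>i = 1..n - 1.
           phi_at \<iota> \<phi> (i + 1) * mps_const (qvar i) * mps_deriv i (Bser \<iota> \<phi> (n - 1) k))"
    using Bser_Suc[OF assms, of k \<phi> "n - 1"] by simp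
qed (simp_all add: Bser_no_roots Bser_many_roots)

end
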